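(* Let $R:\mathcal{I}\times\Omega\to\mathbb{R}$ satisfy (S1), (S2) and (S3) of the context, and consider a sequence of cubes $\{I_{\mathbf{n}_j}\}$ with $I_{\mathbf{n}_1}\subset I_{\mathbf{n}_2}\subset\cdots$ and $I_{\mathbf{n}_j}\to\mathbb{R}^{d}_{+}=\{x\in\mathbb{R}^{d}:x_i\ge0\}$ as $j\to\infty$. Then $\lim_{j\to\infty}\frac{R(I_{\mathbf{n}_j},\omega)}{|I_{\mathbf{n}_j}|}$ exists almost surely, and the convergence is almost sure to a function $R\in L^{1}(\Omega)$. Moreover, $$ \mathbb{E}[R]=\lim_{j\to\infty}\frac{1}{|I_{\mathbf{n}_j}|}\int R(I_{\mathbf{n}_j},\omega)\,d\mathbb{P}. $$ In particular, if $\{\tau_s\}$ is ergodic, then $R(\omega)=\gamma(R):=\inf_{K\in\mathcal{I}}\frac{1}{|K|}\int R(K,\omega)\,d\mathbb{P}$ almost surely.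
   Context: $d$ is an arbitrary dimension. $(\Omega,\mathcal{F},\mathbb{P})$ is a probability space with a measurable, measure-preserving group of transformations $\{\tau_s\}_{s\in\mathbb{R}^d}$ of $\Omega$. $\mathcal{I}$ is the collection of "cubes with sides of arbitrary length" in $\mathbb{R}^d$, i.e. bounded axis-parallel boxes (the side lengths need not be equal or comparable), taken half-open; $|I|$ is the Lebesgue measure of $I$. For $\mathbf{n}=(n^1,\dots,n^d)$ with positive entries, $I_{\mathbf{n}}=[0,n^1)\times\cdots\times[0,n^d)$. $I_{\mathbf{n}_j}\to\mathbb{R}^d_+$ means that the increasing union of the $I_{\mathbf{n}_j}$ is $\mathbb{R}^d_+$. The random process $R(I,\omega)$ (with $R(I,\cdot)$ a random variable for each $I\in\mathcal{I}$) satisfies: (S1) Stationarity: for all $s\in\mathbb{R}^{d}$, $R(s+I,\omega)=R(I,\tau_s\omega)$. (S2) Subadditivity: if $I\in\mathcal{I}$ and $I=I_1\cup I_2$ with $I_1,I_2\in\mathcal{I}$ and $I_1\cap I_2=\emptyset$, then $R(I,\omega)\le R(I_1,\omega)+R(I_2,\omega)$. (S3) There is a constant $C$ such that for all $\omega\in\Omega$ and $I\in\mathcal{I}$, $0\le R(I,\omega)\le C|I|$. *)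

theory Defs
  imports "HOL-Probability.Probability"
begin

text \<open>Dimension \<open>d\<close> is \<open>CARD('n)\<close>, and \<open>\<real>\<^sup>d\<close> is the type \<^typ>\<open>real ^ 'n\<close>.\<close>

definition half_open_box :: "real ^ 'n \<Rightarrow> real ^ 'n \<Rightarrow> (real ^ 'n) set" where
  "half_open_box a b = {x. \<forall>i. a $ i \<le> x $ i \<and> x $ i < b $ i}"

text \<open>The collection of ``cubes'': all sides are positive, so that the empty set is excluded and
  division by the volume is never division by zero. The side lengths are otherwise arbitrary.\<close>

definition cubes :: "(real ^ 'n) set set" where
  "cubes = {half_open_box a b |a b. \<forall>i. a $ i < b $ i}"

abbreviation vol :: "(real ^ 'n) set \<Rightarrow> real" where
  "vol I \<equiv> measure lborel I"

definition corner_cube :: "real ^ 'n \<Rightarrow> (real ^ 'n) set" where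
  "corner_cube u = half_open_box 0 u"

text \<open>A group of measurable, measure-preserving transformations of the space \<open>M\<close>, indexed by
  \<open>\<real>\<^sup>d\<close>. Measurability is required of each transformation separately; this is implied by
  joint measurability of \<open>(s, \<omega>) \<mapsto> \<tau> s \<omega>\<close>, which is not needed.\<close>

definition mp_group :: "'a measure \<Rightarrow> (real ^ 'n \<Rightarrow> 'a \<Rightarrow> 'a) \<Rightarrow> bool" where
  "mp_group M \<tau> \<longleftrightarrow>
     (\<forall>s. \<tau> s \<in> measurable M M \<and> distr M M (\<tau> s) = M) \<and>
     (\<forall>\<omega>\<in>space M. \<tau> 0 \<omega> = \<omega>) \<and>
     (\<forall>s t. \<forall>\<omega>\<in>space M. \<tau> (s + t) \<omega> = \<tau> s (\<tau> t \<omega>))"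

definition ergodic_group :: "'a measure \<Rightarrow> (real ^ 'n \<Rightarrow> 'a \<Rightarrow> 'a) \<Rightarrow> bool" where
  "ergodic_group M \<tau> \<longleftrightarrow>
     (\<forall>A\<in>sets M. (\<forall>s. \<tau> s -` A \<inter> space M = A) \<longrightarrow> measure M A = 0 \<or> measure M A = 1)"

definition cube_process :: "'a measure \<Rightarrow> ((real ^ 'n) set \<Rightarrow> 'a \<Rightarrow> real) \<Rightarrow> bool" where
  "cube_process M R \<longleftrightarrow> (\<forall>I\<in>cubes. R I \<in> borel_measurable M)"

definition stationary ::
  "'a measure \<Rightarrow> (real ^ 'n \<Rightarrow> 'a \<Rightarrow> 'a) \<Rightarrow> ((real ^ 'n) set \<Rightarrow> 'a \<Rightarrow> real) \<Rightarrow> bool" where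
  "stationary M \<tau> R \<longleftrightarrow>
     (\<forall>s. \<forall>I\<in>cubes. \<forall>\<omega>\<in>space M. R ((+) s ` I) \<omega> = R I (\<tau> s \<omega>))"

definition cube_subadditive :: "'a measure \<Rightarrow> ((real ^ 'n) set \<Rightarrow> 'a \<Rightarrow> real) \<Rightarrow> bool" where
  "cube_subadditive M R \<longleftrightarrow>
     (\<forall>I\<in>cubes. \<forall>I\<^sub>1\<in>cubes. \<forall>I\<^sub>2\<in>cubes. I = I\<^sub>1 \<union> I\<^sub>2 \<longrightarrow> I\<^sub>1 \<inter> I\<^sub>2 = {} \<longrightarrow>
        (\<forall>\<omega>\<in>space M. R I \<omega> \<le> R I\<^sub>1 \<omega> + R I\<^sub>2 \<omega>))"

definition volume_bounded :: "'a measure \<Rightarrow> ((real ^ 'n) set \<Rightarrow> 'a \<Rightarrow> real) \<Rightarrow> bool" where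
  "volume_bounded M R \<longleftrightarrow>
     (\<exists>C. \<forall>\<omega>\<in>space M. \<forall>I\<in>cubes. 0 \<le> R I \<omega> \<and> R I \<omega> \<le> C * vol I)"

definition spatial_constant :: "'a measure \<Rightarrow> ((real ^ 'n) set \<Rightarrow> 'a \<Rightarrow> real) \<Rightarrow> real" where
  "spatial_constant M R = (INF K\<in>cubes. 1 / vol K * (\<integral>\<omega>. R K \<omega> \<partial>M))"

end

theory Submission
  imports Defs
begin

text \<open>
  Fix a cube \<open>K\<close> whose mean \<open>E R(K) / |K|\<close> is close to the spatial constant. On boxes of the
  lattice of translates of \<open>K\<close>, the sum of \<open>R\<close> over the tiles minus \<open>R\<close> is a nonnegative
  superadditive process whose mean per unit volume is small, and a weak-type maximal inequality
  makes it uniformly small along the whole increasing sequence off an event of small probability.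
  The tile sums are additive, so their averages converge almost surely. Hence the oscillation of
  \<open>R(I)/|I|\<close> is arbitrarily small with probability arbitrarily close to one.
\<close>

section \<open>The maximal inequality on a lattice\<close>

text \<open>Two facts shape the argument. The sides of the boxes may grow at unrelated rates, and
  \<open>R\<close> is controlled from one side only: a box is bounded by the boxes inside it, at the
  cost of \<open>C\<close> times the remaining volume. So a box is compared with a lattice box just
  inside it for the upper bound and with one just outside it for the lower bound; the rounding costs
  a vanishing fraction of the volume.

  The upper bound by tile averages is plain subadditivity.

  Unrelated growth rates also require tile averages to converge along every sequence of boxes with
  all sides tending to infinity; the volume bound supplies the bounded tile values that make this
  accessible. That the boxes are nested enters through the nesting of dyadic cells.\<close>

definition lbox :: "('n \<Rightarrow> nat) \<Rightarrow> ('n \<Rightarrow> nat) set" where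
  "lbox n = {x. \<forall>i. x i < n i}"

definition axis_pt :: "'n \<Rightarrow> nat \<Rightarrow> 'n \<Rightarrow> nat" where
  "axis_pt i k = (\<lambda>j. if j = i then k else 0)"

lemma lbox_eq_PiE: "lbox n = PiE UNIV (\<lambda>i. {..<n i})"
  by (auto simp: lbox_def PiE_def)

lemma finite_lbox [simp]: "finite (lbox (n :: 'n::finite \<Rightarrow> nat))"
  unfolding lbox_eq_PiE by (intro finite_PiE) auto

lemma card_lbox: "card (lbox (n :: 'n::finite \<Rightarrow> nat)) = (\<Prod>i\<in>UNIV. n i)"
  unfolding lbox_eq_PiE by (subst card_PiE) auto

text \<open>A point of the box splits uniquely into its height on axis \<open>i\<close> and its
  projection to height 0; the box \<open>n(i := 1)\<close> stands for that base slice.\<close>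

lemma sum_lbox_split:
  fixes n :: "'n::finite \<Rightarrow> nat" and \<phi> :: "('n \<Rightarrow> nat) \<Rightarrow> real"
  shows "sum \<phi> (lbox n) = (\<Sum>k<n i. \<Sum>x\<in>lbox (n(i := 1)). \<phi> (\<lambda>j. x j + axis_pt i k j))"
proof -
  have "(\<Sum>k<n i. \<Sum>x\<in>lbox (n(i := 1)). \<phi> (\<lambda>j. x j + axis_pt i k j))
      = (\<Sum>(k, x)\<in>{..<n i} \<times> lbox (n(i := 1)). \<phi> (\<lambda>j. x j + axis_pt i k j))"
    by (simp add: sum.cartesian_product)
  also have "\<dots> = sum \<phi> (lbox n)"
  proof (rule sum.reindex_bij_witness[where i = "\<lambda>x. (x i, x(i := 0))"
        and j = "\<lambda>(k, x) j. x j + axis_pt i k j"], goal_cases)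
    case (1 a)
    then obtain k x where a: "a = (k, x)" and k: "k < n i" and x: "x \<in> lbox (n(i := 1))"
      by auto
    have "x i < (n(i := 1)) i"
      using x unfolding lbox_def by blast
    then have "x i = 0" by simp
    then show ?case by (auto simp: a axis_pt_def)
  next
    case (2 a)
    then obtain k x where a: "a = (k, x)" and k: "k < n i" and x: "x \<in> lbox (n(i := 1))"
      by auto
    have *: "x j < (n(i := 1)) j" for j
      using x unfolding lbox_def by blast
    have "x j + axis_pt i k j < n j" for j
      using *[of j] k by (cases "j = i") (auto simp: axis_pt_def)
    then show ?case by (simp add: a lbox_def)
  next
    case (3 b)
    then show ?case by (auto simp: axis_pt_def)
  next
    case (4 b)
    then show ?case by (auto simp: lbox_def)
  next
    case (5 a)
    then show ?case by auto
  qed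
  finally show ?thesis by simp
qed

lemma prod_fun_upd_one:
  fixes n :: "'n::finite \<Rightarrow> nat"
  shows "(\<Prod>j\<in>UNIV. real (n j)) = real (n i) * (\<Prod>j\<in>UNIV. real ((n(i := 1)) j))"
proof -
  have "(\<Prod>j\<in>UNIV. real ((n(i := 1)) j)) = (\<Prod>j\<in>UNIV - {i}. real (n j))"
    by (subst prod.remove[of _ i]) (auto intro!: prod.cong)
  then show ?thesis
    by (simp add: prod.remove[of _ i])
qed

text \<open>Each period \<open>2 * h\<close> contributes its first \<open>h\<close> residues. Points
  in the lower half of their dyadic cell thus have density one half per coordinate, the source of a
  factor 2 per dimension in the maximal inequality.\<close>

lemma card_lower_half_residues:
  "card {k. k < 2 * h * q \<and> k mod (2 * h) < h} = h * q"
proof (induction q)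
  case (Suc q)
  show ?case
  proof (cases "h = 0")
    case False
    have "{k. k < 2 * h * Suc q \<and> k mod (2 * h) < h}
        = {k. k < 2 * h * q \<and> k mod (2 * h) < h} \<union> {2 * h * q..<2 * h * q + h}" (is "?L = ?A \<union> ?B")
    proof (intro set_eqI iffI)
      fix k assume k: "k \<in> ?L"
      show "k \<in> ?A \<union> ?B"
      proof (cases "k < 2 * h * q")
        case False
        then obtain r where r: "k = 2 * h * q + r" by (metis le_add_diff_inverse not_less)
        with k have "r < 2 * h" by simp
        with k r have "r < h" by simp
        with r show ?thesis by auto
      qed (use k in auto)
    next
      fix k assume "k \<in> ?A \<union> ?B"
      then show "k \<in> ?L"
      proof
        assume "k \<in> ?B"
        then obtain r where r: "k = 2 * h * q + r" "r < h"
          by (metis atLeastLessThan_iff le_add_diff_inverse nat_add_left_cancel_less)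
        then show ?thesis by simp
      qed auto
    qed
    then have "card ?L = card (?A \<union> ?B)" by simp
    also have "\<dots> = card ?A + card ?B"
      by (intro card_Un_disjoint) auto
    finally show ?thesis using Suc by simp
  qed simp
qed simp

section \<open>Actions of the lattice orthant and functionals of boxes under axis-parallel
  cuts\<close>

locale lattice_action = prob_space M for M :: "'a measure" +
  fixes T :: "('n::finite \<Rightarrow> nat) \<Rightarrow> 'a \<Rightarrow> 'a"
  assumes T_measurable [measurable]: "T p \<in> measurable M M"
    and T_distr: "distr M M (T p) = M"
    and T_zero: "\<omega> \<in> space M \<Longrightarrow> T (\<lambda>_. 0) \<omega> = \<omega>"
    and T_add: "\<omega> \<in> space M \<Longrightarrow> T (\<lambda>i. p i + q i) \<omega> = T p (T q \<omega>)"
begin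

lemma T_space [simp]: "\<omega> \<in> space M \<Longrightarrow> T p \<omega> \<in> space M"
  by (rule measurable_space[OF T_measurable])

lemma integral_T:
  fixes f :: "'a \<Rightarrow> real"
  assumes [measurable]: "f \<in> borel_measurable M"
  shows "(\<integral>\<omega>. f (T p \<omega>) \<partial>M) = (\<integral>\<omega>. f \<omega> \<partial>M)"
  by (subst (2) T_distr[of p, symmetric]) (simp add: integral_distr)

definition box_sum :: "('a \<Rightarrow> real) \<Rightarrow> ('n \<Rightarrow> nat) \<Rightarrow> 'a \<Rightarrow> real" where
  "box_sum g n \<omega> = (\<Sum>x\<in>lbox n. g (T x \<omega>))"

lemma box_sum_measurable [measurable]:
  assumes [measurable]: "g \<in> borel_measurable M"
  shows "box_sum g n \<in> borel_measurable M"
  unfolding box_sum_def by measurable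

lemma box_sum_slices:
  assumes "\<omega> \<in> space M"
  shows "box_sum g n \<omega> = (\<Sum>k<n i. box_sum g (n(i := 1)) (T (axis_pt i k) \<omega>))"
  unfolding box_sum_def by (subst sum_lbox_split[of _ _ i]) (simp add: T_add assms)

lemma T_axis_add:
  assumes "\<omega> \<in> space M"
  shows "T (axis_pt i (a + b)) \<omega> = T (axis_pt i a) (T (axis_pt i b) \<omega>)"
proof -
  have "axis_pt i (a + b) = (\<lambda>j. axis_pt i a j + axis_pt i b j)"
    by (auto simp: axis_pt_def)
  then show ?thesis by (simp add: T_add assms)
qed

lemma T_axis_zero: "\<omega> \<in> space M \<Longrightarrow> T (axis_pt i 0) \<omega> = \<omega>"
  using T_zero by (simp add: axis_pt_def)

lemma box_sum_add:
  assumes \<omega>: "\<omega> \<in> space M" and n: "n i = a + b"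
  shows "box_sum g n \<omega> = box_sum g (n(i := a)) \<omega> + box_sum g (n(i := b)) (T (axis_pt i a) \<omega>)"
proof -
  let ?f = "\<lambda>k. box_sum g (n(i := 1)) (T (axis_pt i k) \<omega>)"
  have "box_sum g n \<omega> = (\<Sum>k<a + b. ?f k)"
    by (subst box_sum_slices[OF \<omega>, of _ _ i]) (simp add: n)
  also have "\<dots> = (\<Sum>k<a. ?f k) + (\<Sum>k<b. ?f (k + a))"
    by (induction b) (simp_all add: ac_simps)
  also have "(\<Sum>k<b. ?f (k + a)) = box_sum g (n(i := b)) (T (axis_pt i a) \<omega>)"
    by (subst box_sum_slices[OF T_space[OF \<omega>], of _ _ _ i]) (simp add: T_axis_add \<omega>)
  also have "(\<Sum>k<a. ?f k) = box_sum g (n(i := a)) \<omega>"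
    by (subst box_sum_slices[OF \<omega>, of _ _ i]) simp
  finally show ?thesis .
qed

text \<open>A grid of equal cells arises by cutting along one axis at a time: \<open>line\<close>
  treats a single axis, and the induction enlarges the set \<open>S\<close> of axes that are really
  subdivided. \<open>F\<close> may take negative values, so the lemma also serves for the negative
  of a subadditive process; \<open>degenerate\<close> covers an axis with no cells.\<close>

lemma grid_superadditive:
  fixes F :: "('n \<Rightarrow> nat) \<Rightarrow> 'a \<Rightarrow> real"
  assumes super: "\<And>n i a b \<omega>. \<omega> \<in> space M \<Longrightarrow> n i = a + b \<Longrightarrow>
      F (n(i := a)) \<omega> + F (n(i := b)) (T (axis_pt i a) \<omega>) \<le> F n \<omega>"
    and degenerate: "\<And>n i \<omega>. \<omega> \<in> space M \<Longrightarrow> n i = 0 \<Longrightarrow> 0 \<le> F n \<omega>"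
    and \<omega>: "\<omega> \<in> space M"
  shows "(\<Sum>y\<in>lbox c. F m (T (\<lambda>i. y i * m i) \<omega>)) \<le> F (\<lambda>i. c i * m i) \<omega>"
proof -
  have line: "(\<Sum>k<q. F (n(i := l)) (T (axis_pt i (k * l)) \<omega>)) \<le> F (n(i := q * l)) \<omega>"
    if \<omega>: "\<omega> \<in> space M" for q n i l \<omega>
  proof (induction q)
    case 0
    then show ?case using degenerate[OF \<omega>, of "n(i := 0)" i] by (simp add: fun_upd_def)
  next
    case (Suc q)
    show ?case
    proof -
      have "F (n(i := q * l)) \<omega> + F (n(i := l)) (T (axis_pt i (q * l)) \<omega>) \<le> F (n(i := Suc q * l)) \<omega>"
        using super[OF \<omega>, of "n(i := Suc q * l)" i "q * l" l] by (simp only: fun_upd_upd fun_upd_same) (simp add: add.commute)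
      with Suc show ?thesis by (simp only: sum.lessThan_Suc)
    qed
  qed
  have "finite S \<Longrightarrow> \<forall>\<omega>\<in>space M. \<forall>c. (\<forall>i. i \<notin> S \<longrightarrow> c i = 1) \<longrightarrow>
      (\<Sum>y\<in>lbox c. F m (T (\<lambda>i. y i * m i) \<omega>)) \<le> F (\<lambda>i. c i * m i) \<omega>" for S
  proof (induction S rule: finite_induct)
    case empty
    have one: "lbox (\<lambda>_::'n. 1::nat) = {\<lambda>_. 0}"
      by (auto simp: lbox_def)
    show ?case
    proof (intro ballI allI impI)
      fix \<omega> and c :: "'n \<Rightarrow> nat"
      assume "\<omega> \<in> space M" "\<forall>i. i \<notin> {} \<longrightarrow> c i = 1"
      moreover from this have "c = (\<lambda>_. 1)" by auto
      ultimately show "(\<Sum>y\<in>lbox c. F m (T (\<lambda>i. y i * m i) \<omega>)) \<le> F (\<lambda>i. c i * m i) \<omega>"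
        using one by (simp add: T_zero)
    qed
  next
    case (insert i S)
    show ?case
    proof (intro ballI allI impI)
      fix \<omega> and c :: "'n \<Rightarrow> nat"
      assume \<omega>: "\<omega> \<in> space M" and c: "\<forall>j. j \<notin> insert i S \<longrightarrow> c j = 1"
      have shift: "T (\<lambda>j. (x j + axis_pt i k j) * m j) \<omega>
          = T (\<lambda>j. x j * m j) (T (axis_pt i (k * m i)) \<omega>)" for x k
      proof -
        have "(\<lambda>j. (x j + axis_pt i k j) * m j) = (\<lambda>j. x j * m j + axis_pt i (k * m i) j)"
          by (auto simp: axis_pt_def algebra_simps)
        then show ?thesis by (simp add: T_add \<omega>)
      qed
      have "(\<Sum>y\<in>lbox c. F m (T (\<lambda>i. y i * m i) \<omega>))
          = (\<Sum>k<c i. \<Sum>x\<in>lbox (c(i := 1)). F m (T (\<lambda>j. x j * m j) (T (axis_pt i (k * m i)) \<omega>)))"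
        by (subst sum_lbox_split[of _ _ i]) (simp add: shift)
      also have "\<dots> \<le> (\<Sum>k<c i. F (\<lambda>j. (c(i := 1)) j * m j) (T (axis_pt i (k * m i)) \<omega>))"
        by (intro sum_mono insert.IH[rule_format] T_space \<omega>) (use c in auto)
      also have "(\<lambda>j. (c(i := 1)) j * m j) = (\<lambda>j. c j * m j)(i := m i)"
        by auto
      also have "(\<Sum>k<c i. F ((\<lambda>j. c j * m j)(i := m i)) (T (axis_pt i (k * m i)) \<omega>))
          \<le> F ((\<lambda>j. c j * m j)(i := c i * m i)) \<omega>"
        by (rule line[OF \<omega>])
      also have "(\<lambda>j. c j * m j)(i := c i * m i) = (\<lambda>j. c j * m j)"
        by auto
      finally show "(\<Sum>y\<in>lbox c. F m (T (\<lambda>i. y i * m i) \<omega>)) \<le> F (\<lambda>i. c i * m i) \<omega>" .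
    qed
  qed
  from this[of UNIV] \<omega> show ?thesis by simp
qed

end

section \<open>Dyadic maximal inequality for nonnegative superadditive processes\<close>

locale superadditive_lattice_process = lattice_action M T
  for M :: "'a measure" and T :: "('n::finite \<Rightarrow> nat) \<Rightarrow> 'a \<Rightarrow> 'a" +
  fixes F :: "('n \<Rightarrow> nat) \<Rightarrow> 'a \<Rightarrow> real" and \<epsilon> :: real
  assumes F_integrable: "integrable M (F n)"
    and F_nonneg: "\<omega> \<in> space M \<Longrightarrow> 0 \<le> F n \<omega>"
    and F_super: "\<omega> \<in> space M \<Longrightarrow> n i = a + b \<Longrightarrow>
      F (n(i := a)) \<omega> + F (n(i := b)) (T (axis_pt i a) \<omega>) \<le> F n \<omega>"
    and F_mean: "(\<integral>\<omega>. F n \<omega> \<partial>M) \<le> \<epsilon> * (\<Prod>i\<in>UNIV. real (n i))"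
begin

lemma F_measurable [measurable]: "F n \<in> borel_measurable M"
  using F_integrable by auto

text \<open>A subbox is reached by at most two cuts per axis, one removing the part above and one
  the part below; nonnegativity discards what is removed. The set \<open>S\<close> collects the axes
  already trimmed.\<close>

lemma F_subbox_le:
  assumes \<omega>: "\<omega> \<in> space M" and le: "\<And>i. p i + m i \<le> n i"
  shows "F m (T p \<omega>) \<le> F n \<omega>"
proof -
  have step: "F (n(i := b)) (T (axis_pt i a) \<omega>) \<le> F n \<omega>"
    if "\<omega> \<in> space M" "a + b \<le> n i" for n i a b \<omega>
  proof -
    have "F (n(i := b)) (T (axis_pt i a) \<omega>) \<le> F (n(i := a + b)) \<omega>"
      using F_super[OF that(1), of "n(i := a + b)" i a b] F_nonneg[OF that(1), of "n(i := a)"] by simp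
    also have "\<dots> \<le> F n \<omega>"
      using F_super[OF that(1), of n i "a + b" "n i - (a + b)"] that
        F_nonneg[OF T_space[OF that(1)], of "n(i := n i - (a + b))" "axis_pt i (a + b)"] by simp
    finally show ?thesis .
  qed
  have "finite S \<Longrightarrow> \<forall>\<omega>\<in>space M. F (\<lambda>i. if i \<in> S then m i else n i)
      (T (\<lambda>i. if i \<in> S then p i else 0) \<omega>) \<le> F n \<omega>" for S
  proof (induction S rule: finite_induct)
    case empty
    then show ?case by (simp add: T_zero)
  next
    case (insert i S)
    show ?case
    proof
      fix \<omega> assume \<omega>: "\<omega> \<in> space M"
      have 1: "(\<lambda>j. if j \<in> insert i S then m j else n j) = (\<lambda>j. if j \<in> S then m j else n j)(i := m i)"
        by auto
      have 2: "(\<lambda>j. if j \<in> insert i S then p j else 0)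
          = (\<lambda>j. axis_pt i (p i) j + (if j \<in> S then p j else 0))"
        using insert.hyps by (auto simp: axis_pt_def)
      have "F (\<lambda>j. if j \<in> insert i S then m j else n j) (T (\<lambda>j. if j \<in> insert i S then p j else 0) \<omega>)
         \<le> F (\<lambda>j. if j \<in> S then m j else n j) (T (\<lambda>i. if i \<in> S then p i else 0) \<omega>)"
        unfolding 1 2 T_add[OF \<omega>] by (rule step) (use le insert.hyps \<omega> in auto)
      then show "F (\<lambda>j. if j \<in> insert i S then m j else n j)
          (T (\<lambda>j. if j \<in> insert i S then p j else 0) \<omega>) \<le> F n \<omega>"
        using insert.IH[rule_format, OF \<omega>] by (rule order_trans)
    qed
  qed
  from this[of UNIV] \<omega> show ?thesis by simp
qed

text \<open>
  Binary superadditivity says nothing about partitions that cannot be produced by successive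
  cuts, which rules out a Vitali covering. Dyadic cells are produced by cuts, and a lattice point in
  the lower half of its dyadic cell has its whole box inside that cell.
\<close>
lemma maximal_inequality_finite:
  fixes n :: "nat \<Rightarrow> 'n \<Rightarrow> nat"
  assumes pos: "\<And>j i. 0 < n j i" and mono: "\<And>i. mono (\<lambda>j. n j i)" and \<theta>: "0 < \<theta>"
  shows "prob {\<omega>\<in>space M. \<exists>j\<le>r. \<theta> * (\<Prod>i\<in>UNIV. real (n j i)) < F (n j) \<omega>}
    \<le> 8 ^ CARD('n) * \<epsilon> / \<theta>"
proof -
  \<comment> \<open>\<open>D j i\<close> is the least power of two that is at least
    \<open>2 * n j i\<close>, hence at most \<open>4 * n j i\<close>. The lower bound leaves room
    for a box of side \<open>n j i\<close> that starts in the lower half of a cell. The upper bound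
    costs a factor 4 per dimension and the density of \<open>good\<close> points a factor 2, which
    gives the 8.\<close>
  define e where "e j i = (LEAST e. 2 * n j i \<le> 2 ^ e)" for j i
  define D where "D j i = (2::nat) ^ e j i" for j i
  define bad where "bad j \<omega> \<longleftrightarrow> \<theta> * (\<Prod>i\<in>UNIV. real (n j i)) < F (n j) \<omega>" for j \<omega>
  define good where "good j x \<longleftrightarrow> (\<forall>i. x i mod D j i < D j i div 2)" for j and x :: "'n \<Rightarrow> nat"
  have ex: "\<exists>e. 2 * n j i \<le> 2 ^ e" for j i
    by (meson less_exp less_imp_le)
  have D_ge: "2 * n j i \<le> D j i" for j i
    unfolding D_def e_def by (rule LeastI_ex[OF ex])
  have e_pos: "0 < e j i" for j i
    using D_ge[of j i] pos[of j i] unfolding D_def by (cases "e j i") auto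
  have D_le: "D j i \<le> 4 * n j i" for j i
  proof -
    obtain k where k: "e j i = Suc k" using e_pos[of j i] gr0_implies_Suc by blast
    have "\<not> 2 * n j i \<le> 2 ^ k"
      using not_less_Least[of k "\<lambda>e. 2 * n j i \<le> 2 ^ e"] k unfolding e_def by auto
    then show ?thesis by (simp add: D_def k)
  qed
  \<comment> \<open>Monotone sides give monotone dyadic scales, so the cells of scale
    \<open>j\<close> subdivide those of every later scale.\<close>
  have e_mono: "e j i \<le> e l i" if "j \<le> l" for j l i
    unfolding e_def
  proof (rule Least_le)
    have "2 * n j i \<le> 2 * n l i" using monoD[OF mono[of i] that] by simp
    also have "\<dots> \<le> 2 ^ (LEAST e. 2 * n l i \<le> 2 ^ e)" by (rule LeastI_ex[OF ex])
    finally show "2 * n j i \<le> 2 ^ (LEAST e. 2 * n l i \<le> 2 ^ e)" .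
  qed
  have D_dvd: "D j i dvd D l i" if "j \<le> l" for j l i
    unfolding D_def using e_mono[OF that] by (rule le_imp_power_dvd)
  have D_pos: "0 < D j i" for j i by (simp add: D_def)
  have D_prod_le: "(\<Prod>i\<in>UNIV. real (D j i)) \<le> 4 ^ CARD('n) * (\<Prod>i\<in>UNIV. real (n j i))" for j
  proof -
    have "(\<Prod>i\<in>UNIV. real (D j i)) \<le> (\<Prod>i\<in>UNIV. 4 * real (n j i))"
      using D_le[of j] by (intro prod_mono) (metis of_nat_0_le_iff of_nat_le_iff of_nat_mult of_nat_numeral)
    then show ?thesis by (simp add: prod.distrib)
  qed
  have F0: "0 \<le> F k \<omega>" if "\<omega> \<in> space M" for k \<omega> by (rule F_nonneg[OF that])

  \<comment> \<open>The points of the cell of scale \<open>l\<close> at the origin that are bad and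
    good at a common scale up to \<open>l\<close>. The claim \<open>count\<close> charges them to
    \<open>F\<close> of that cell.\<close>
  define V where "V l \<omega> = {x\<in>lbox (D l). \<exists>j\<le>l. bad j (T x \<omega>) \<and> good j x}" for l \<omega>
  have finV: "finite (V l \<omega>)" for l \<omega> unfolding V_def by (rule finite_subset[OF _ finite_lbox[of "D l"]]) blast
  \<comment> \<open>A single point that is bad and good at the top scale pays for the whole cell:
    its box lies inside the cell and fills a fixed fraction of it.\<close>
  have top: "\<theta> * card (V l \<omega>) \<le> 4 ^ CARD('n) * F (D l) \<omega>"
    if \<omega>: "\<omega> \<in> space M" and x: "x \<in> lbox (D l)" "bad l (T x \<omega>)" "good l x" for l \<omega> x
  proof -
    have "x i + n l i \<le> D l i" for i
    proof -
      have "x i < D l i" using x(1) unfolding lbox_def by blast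
      moreover have "x i mod D l i < D l i div 2" using x(3) unfolding good_def by blast
      ultimately have "x i < D l i div 2" by simp
      then show ?thesis using D_ge[of l i] by simp
    qed
    then have "F (n l) (T x \<omega>) \<le> F (D l) \<omega>"
      by (intro F_subbox_le \<omega>)
    then have F: "\<theta> * (\<Prod>i\<in>UNIV. real (n l i)) \<le> F (D l) \<omega>"
      using x(2) unfolding bad_def by simp
    have "card (V l \<omega>) \<le> card (lbox (D l))"
      by (intro card_mono) (auto simp: V_def)
    then have "real (card (V l \<omega>)) \<le> (\<Prod>i\<in>UNIV. real (D l i))"
      unfolding card_lbox of_nat_prod[symmetric] by (rule of_nat_mono)
    also note D_prod_le[of l]
    finally have "\<theta> * card (V l \<omega>) \<le> \<theta> * (4 ^ CARD('n) * (\<Prod>i\<in>UNIV. real (n l i)))"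
      using \<theta> by simp
    also have "\<dots> = 4 ^ CARD('n) * (\<theta> * (\<Prod>i\<in>UNIV. real (n l i)))" by simp
    also have "\<dots> \<le> 4 ^ CARD('n) * F (D l) \<omega>"
      using F by (intro mult_left_mono) auto
    finally show ?thesis .
  qed
  \<comment> \<open>Stopping argument: either some point is bad and good at the top scale and
    \<open>top\<close> applies, or every counted point belongs to a smaller scale, and
    superadditivity adds up the estimates for the subcells.\<close>
  have count: "\<theta> * card (V l \<omega>) \<le> 4 ^ CARD('n) * F (D l) \<omega>" if "\<omega> \<in> space M" for l \<omega>
    using that
  proof (induction l arbitrary: \<omega>)
    case 0
    show ?case
    proof (cases "V 0 \<omega> = {}")
      case True
      then show ?thesis using F0[OF 0] by simp
    next
      case False
      then obtain x where "x \<in> lbox (D 0)" "bad 0 (T x \<omega>)" "good 0 x"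
        unfolding V_def by auto
      then show ?thesis by (rule top[OF 0])
    qed
  next
    case (Suc l)
    note \<omega> = Suc.prems
    show ?case
    proof (cases "\<exists>x\<in>lbox (D (Suc l)). bad (Suc l) (T x \<omega>) \<and> good (Suc l) x")
      case True
      then show ?thesis using top[OF \<omega>] by blast
    next
      case False
      define c where "c i = D (Suc l) i div D l i" for i
      have cD: "c i * D l i = D (Suc l) i" for i
        unfolding c_def using D_dvd[of l "Suc l" i] by simp
      have "V (Suc l) \<omega> \<subseteq> (\<Union>y\<in>lbox c. (\<lambda>x i. y i * D l i + x i) ` V l (T (\<lambda>i. y i * D l i) \<omega>))"
      proof
        fix z assume z: "z \<in> V (Suc l) \<omega>"
        then have zb: "z \<in> lbox (D (Suc l))" unfolding V_def by blast
        obtain j where j: "j \<le> Suc l" "bad j (T z \<omega>)" "good j z"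
          using z unfolding V_def by blast
        with False zb have "j \<noteq> Suc l" by blast
        with j have jl: "j \<le> l" by simp
        define y where "y i = z i div D l i" for i
        define x where "x i = z i mod D l i" for i
        have zxy: "z = (\<lambda>i. x i + y i * D l i)"
          unfolding x_def y_def by auto
        have "y i < c i" for i
        proof -
          have "z i < D (Suc l) i" using zb unfolding lbox_def by blast
          then show ?thesis unfolding y_def by (intro less_mult_imp_div_less) (simp only: cD)
        qed
        then have yc: "y \<in> lbox c" unfolding lbox_def by simp
        have "T z \<omega> = T x (T (\<lambda>i. y i * D l i) \<omega>)"
          unfolding zxy by (rule T_add[OF \<omega>])
        \<comment> \<open>Moving a subcell to the origin shifts the coordinates by multiples of
          \<open>D l i\<close>, hence of \<open>D j i\<close>; the position within the cell of scale
          \<open>j\<close> is unchanged.\<close>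
        moreover have "good j x"
          unfolding good_def x_def
        proof
          fix i
          have "z i mod D l i mod D j i = z i mod D j i"
            using D_dvd[OF jl] by (rule mod_mod_cancel)
          then show "z i mod D l i mod D j i < D j i div 2"
            using j(3) unfolding good_def by simp
        qed
        moreover have "x \<in> lbox (D l)"
          unfolding lbox_def x_def using D_pos by simp
        ultimately have "x \<in> V l (T (\<lambda>i. y i * D l i) \<omega>)"
          unfolding V_def using j jl by (simp only: mem_Collect_eq) blast
        with yc show "z \<in> (\<Union>y\<in>lbox c. (\<lambda>x i. y i * D l i + x i) ` V l (T (\<lambda>i. y i * D l i) \<omega>))"
          by (intro UN_I[of y] image_eqI[of _ _ x]) (auto simp only: zxy add.commute)
      qed
      then have "card (V (Suc l) \<omega>)
          \<le> card (\<Union>y\<in>lbox c. (\<lambda>x i. y i * D l i + x i) ` V l (T (\<lambda>i. y i * D l i) \<omega>))"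
        by (intro card_mono) (auto simp: finV)
      also have "\<dots> \<le> (\<Sum>y\<in>lbox c. card ((\<lambda>x i. y i * D l i + x i) ` V l (T (\<lambda>i. y i * D l i) \<omega>)))"
        by (intro card_UN_le) simp
      also have "\<dots> \<le> (\<Sum>y\<in>lbox c. card (V l (T (\<lambda>i. y i * D l i) \<omega>)))"
        by (intro sum_mono card_image_le finV)
      finally have "\<theta> * card (V (Suc l) \<omega>) \<le> \<theta> * (\<Sum>y\<in>lbox c. real (card (V l (T (\<lambda>i. y i * D l i) \<omega>))))"
        using \<theta> unfolding of_nat_sum[symmetric] by (intro mult_left_mono of_nat_mono) simp_all
      also have "\<dots> = (\<Sum>y\<in>lbox c. \<theta> * card (V l (T (\<lambda>i. y i * D l i) \<omega>)))"
        by (simp add: sum_distrib_left)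
      also have "\<dots> \<le> (\<Sum>y\<in>lbox c. 4 ^ CARD('n) * F (D l) (T (\<lambda>i. y i * D l i) \<omega>))"
        by (intro sum_mono Suc.IH T_space \<omega>)
      also have "\<dots> = 4 ^ CARD('n) * (\<Sum>y\<in>lbox c. F (D l) (T (\<lambda>i. y i * D l i) \<omega>))"
        by (simp add: sum_distrib_left)
      also have "\<dots> \<le> 4 ^ CARD('n) * F (\<lambda>i. c i * D l i) \<omega>"
        by (intro mult_left_mono grid_superadditive F_super F_nonneg \<omega>) auto
      finally show ?thesis by (simp add: cD)
    qed
  qed

  \<comment> \<open>Sorting by the first bad index makes the events disjoint, so that a lattice
    point is counted for one \<open>j\<close> only even if it is good at several scales.\<close>
  define E where "E j = {\<omega>\<in>space M. bad j \<omega> \<and> (\<forall>k<j. \<not> bad k \<omega>)}" for j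
  define G where "G j = {x\<in>lbox (D r). good j x}" for j
  have E_meas [measurable]: "E j \<in> sets M" for j
    unfolding E_def bad_def by measurable
  have E_disj: "disjoint_family_on E {..r}"
    unfolding disjoint_family_on_def
  proof (intro ballI impI)
    fix j k :: nat assume "j \<noteq> k"
    then have "j < k \<or> k < j" by auto
    then show "E j \<inter> E k = {}" unfolding E_def by blast
  qed
  have E_Un: "{\<omega>\<in>space M. \<exists>j\<le>r. bad j \<omega>} = (\<Union>j\<le>r. E j)"
  proof (intro set_eqI iffI)
    fix \<omega> assume "\<omega> \<in> {\<omega>\<in>space M. \<exists>j\<le>r. bad j \<omega>}"
    then obtain j where \<omega>: "\<omega> \<in> space M" and j: "j \<le> r" "bad j \<omega>" by auto
    define k where "k = (LEAST k. bad k \<omega>)"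
    have "bad k \<omega>" unfolding k_def by (rule LeastI[of "\<lambda>k. bad k \<omega>" j, OF j(2)])
    moreover have "\<forall>l<k. \<not> bad l \<omega>" unfolding k_def by (blast dest: not_less_Least)
    ultimately have "\<omega> \<in> E k" using \<omega> unfolding E_def by blast
    moreover have "k \<le> r" using Least_le[of "\<lambda>k. bad k \<omega>" j, OF j(2)] j(1) unfolding k_def by simp
    ultimately show "\<omega> \<in> (\<Union>j\<le>r. E j)" by blast
  qed (use E_def in blast)
  have card_G: "2 ^ CARD('n) * real (card (G j)) = (\<Prod>i\<in>UNIV. real (D r i))" if jr: "j \<le> r" for j
  proof -
    define H where "H i = {k. k < D r i \<and> k mod D j i < D j i div 2}" for i
    have half: "2 * card (H i) = D r i" for i
    proof -
      obtain a where a: "e j i = Suc a" using e_pos[of j i] gr0_implies_Suc by blast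
      obtain q where q: "D r i = D j i * q" using D_dvd[OF jr, of i] by (rule dvdE)
      have Dj: "D j i = 2 * 2 ^ a" by (simp add: D_def a)
      have "card (H i) = 2 ^ a * q"
        using card_lower_half_residues[of "2 ^ a" q] unfolding H_def q Dj by simp
      then show ?thesis unfolding q Dj by simp
    qed
    have "G j = PiE UNIV H"
      unfolding G_def lbox_def good_def H_def by (auto simp: PiE_iff)
    then have "card (G j) = (\<Prod>i\<in>UNIV. card (H i))"
      by (simp add: card_PiE)
    then have "2 ^ CARD('n) * real (card (G j)) = (\<Prod>i\<in>(UNIV::'n set). 2 * real (card (H i)))"
      by (simp add: prod.distrib)
    also have "\<dots> = (\<Prod>i\<in>UNIV. real (D r i))"
    proof (intro prod.cong refl)
      show "2 * real (card (H i)) = real (D r i)" for i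
        unfolding half[of i, symmetric] by simp
    qed
    finally show ?thesis .
  qed
  \<comment> \<open>For fixed \<open>\<omega>\<close> the double sum is the number of points
    \<open>x\<close> of the top cell that are good at the first bad index of
    \<open>T x \<omega>\<close>; all of them lie in \<open>V r \<omega>\<close>.\<close>
  have ptw: "\<theta> * (\<Sum>j\<le>r. \<Sum>x\<in>G j. indicator (E j) (T x \<omega>)) \<le> 4 ^ CARD('n) * F (D r) \<omega>"
    if \<omega>: "\<omega> \<in> space M" for \<omega>
  proof -
    have finG: "finite (G j)" for j
      unfolding G_def by (rule finite_subset[OF _ finite_lbox[of "D r"]]) blast
    have "(\<Sum>j\<le>r. \<Sum>x\<in>G j. indicator (E j) (T x \<omega>) :: real)
        = (\<Sum>j\<le>r. real (card {x\<in>G j. T x \<omega> \<in> E j}))"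
      unfolding real_of_card sum.inter_filter[OF finG] by (simp only: indicator_def of_bool_def)
    also have "\<dots> = real (card (\<Union>j\<le>r. {x\<in>G j. T x \<omega> \<in> E j}))"
      unfolding of_nat_sum[symmetric]
    proof (subst card_UN_disjoint)
      show "\<forall>j\<in>{..r}. \<forall>k\<in>{..r}. j \<noteq> k \<longrightarrow> {x \<in> G j. T x \<omega> \<in> E j} \<inter> {x \<in> G k. T x \<omega> \<in> E k} = {}"
        using E_disj unfolding disjoint_family_on_def by blast
    qed (auto intro: finite_subset[OF _ finG])
    also have "\<dots> \<le> real (card (V r \<omega>))"
      by (intro of_nat_mono card_mono finV) (auto simp: V_def G_def E_def)
    finally have "\<theta> * (\<Sum>j\<le>r. \<Sum>x\<in>G j. indicator (E j) (T x \<omega>)) \<le> \<theta> * real (card (V r \<omega>))"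
      using \<theta> by simp
    also note count[OF \<omega>, of r]
    finally show ?thesis .
  qed
  have intE: "(\<integral>\<omega>. indicator (E j) (T x \<omega>) \<partial>M) = prob (E j)" for j x
    using integral_T[of "indicator (E j)" x] by simp
  have int_ind: "integrable M (\<lambda>\<omega>. indicator (E j) (T x \<omega>) :: real)" for j x
    by (intro integrable_const_bound[where B=1]) (auto simp: indicator_def)
  let ?P = "\<Prod>i\<in>UNIV. real (D r i)"
  have P_pos: "0 < ?P" using D_pos by (intro prod_pos) auto
  \<comment> \<open>After integration each indicator contributes \<open>prob (E j)\<close> whatever
    the point, and every \<open>G j\<close> is the same fraction of the top cell. The weights are
    therefore equal and the probabilities add up to that of the union.\<close>
  have "\<theta> * (?P * prob (\<Union>j\<le>r. E j)) = \<theta> * (\<Sum>j\<le>r. ?P * prob (E j))"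
    using E_disj by (subst finite_measure_finite_Union) (auto simp: sum_distrib_left)
  also have "\<dots> = 2 ^ CARD('n) * (\<theta> * (\<Sum>j\<le>r. real (card (G j)) * prob (E j)))"
    by (simp add: card_G[symmetric] sum_distrib_left mult_ac)
  also have "(\<theta> * (\<Sum>j\<le>r. real (card (G j)) * prob (E j)))
      = (\<integral>\<omega>. \<theta> * (\<Sum>j\<le>r. \<Sum>x\<in>G j. indicator (E j) (T x \<omega>)) \<partial>M)"
    by (simp add: int_ind intE)
  also have "2 ^ CARD('n) * \<dots> \<le> 2 ^ CARD('n) * (\<integral>\<omega>. 4 ^ CARD('n) * F (D r) \<omega> \<partial>M)"
    using ptw F_integrable int_ind by (intro mult_left_mono integral_mono) auto
  also have "\<dots> = 8 ^ CARD('n) * (\<integral>\<omega>. F (D r) \<omega> \<partial>M)"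
    by (simp add: mult.assoc[symmetric] power_mult_distrib[symmetric])
  also have "\<dots> \<le> 8 ^ CARD('n) * (\<epsilon> * ?P)"
    by (intro mult_left_mono F_mean) auto
  finally have "prob (\<Union>j\<le>r. E j) \<le> 8 ^ CARD('n) * \<epsilon> / \<theta>"
    using P_pos \<theta> by (simp add: field_simps)
  then show ?thesis using E_Un unfolding bad_def by simp
qed

lemma maximal_inequality:
  fixes n :: "nat \<Rightarrow> 'n \<Rightarrow> nat"
  assumes pos: "\<And>j i. 0 < n j i" and mono: "\<And>i. mono (\<lambda>j. n j i)" and \<theta>: "0 < \<theta>"
  shows "prob {\<omega>\<in>space M. \<exists>j. \<theta> * (\<Prod>i\<in>UNIV. real (n j i)) < F (n j) \<omega>}
    \<le> 8 ^ CARD('n) * \<epsilon> / \<theta>"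
proof -
  let ?B = "\<lambda>r. {\<omega>\<in>space M. \<exists>j\<le>r. \<theta> * (\<Prod>i\<in>UNIV. real (n j i)) < F (n j) \<omega>}"
  have "(\<lambda>r. prob (?B r)) \<longlonglongrightarrow> prob (\<Union>r. ?B r)"
    by (intro finite_Lim_measure_incseq) (auto simp: incseq_def intro: order_trans)
  moreover have "(\<Union>r. ?B r) = {\<omega>\<in>space M. \<exists>j. \<theta> * (\<Prod>i\<in>UNIV. real (n j i)) < F (n j) \<omega>}"
    by auto
  ultimately show ?thesis
    using maximal_inequality_finite[OF assms] by (intro LIMSEQ_le_const2) auto
qed

end

section \<open>The ergodic theorem for one transformation\<close>

locale mp_map = prob_space M for M :: "'a measure" +
  fixes S :: "'a \<Rightarrow> 'a"
  assumes S_measurable [measurable]: "S \<in> measurable M M"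
    and S_distr: "distr M M S = M"
begin

lemma S_space [simp]: "\<omega> \<in> space M \<Longrightarrow> S \<omega> \<in> space M"
  by (rule measurable_space[OF S_measurable])

lemma funpow_space [simp]: "\<omega> \<in> space M \<Longrightarrow> (S ^^ k) \<omega> \<in> space M"
  by (induction k) auto

lemma funpow_measurable [measurable]: "S ^^ k \<in> measurable M M"
  by (induction k) auto

lemma integral_S:
  fixes f :: "'a \<Rightarrow> real"
  assumes [measurable]: "f \<in> borel_measurable M"
  shows "(\<integral>\<omega>. f (S \<omega>) \<partial>M) = (\<integral>\<omega>. f \<omega> \<partial>M)"
  by (subst (2) S_distr[symmetric]) (simp add: integral_distr)

lemma integral_funpow:
  fixes f :: "'a \<Rightarrow> real"
  assumes [measurable]: "f \<in> borel_measurable M"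
  shows "(\<integral>\<omega>. f ((S ^^ k) \<omega>) \<partial>M) = (\<integral>\<omega>. f \<omega> \<partial>M)"
proof (induction k)
  case (Suc k)
  have "(\<integral>\<omega>. f ((S ^^ Suc k) \<omega>) \<partial>M) = (\<integral>\<omega>. f ((S ^^ k) (S \<omega>)) \<partial>M)"
    by (simp only: funpow_Suc_right o_apply)
  also have "\<dots> = (\<integral>\<omega>. f ((S ^^ k) \<omega>) \<partial>M)"
    by (rule integral_S) measurable
  finally show ?case using Suc by simp
qed simp

section \<open>Birkhoff sums and the maximal ergodic lemma\<close>

definition birkhoff_sum :: "('a \<Rightarrow> real) \<Rightarrow> nat \<Rightarrow> 'a \<Rightarrow> real" where
  "birkhoff_sum h k \<omega> = (\<Sum>i<k. h ((S ^^ i) \<omega>))"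

lemma birkhoff_sum_measurable [measurable]:
  assumes [measurable]: "h \<in> borel_measurable M"
  shows "birkhoff_sum h k \<in> borel_measurable M"
  unfolding birkhoff_sum_def by measurable

lemma birkhoff_sum_Suc: "birkhoff_sum h (Suc k) \<omega> = h \<omega> + birkhoff_sum h k (S \<omega>)"
proof -
  have "birkhoff_sum h (Suc k) \<omega> = h \<omega> + (\<Sum>i<k. h ((S ^^ Suc i) \<omega>))"
    unfolding birkhoff_sum_def by (subst sum.lessThan_Suc_shift) simp
  then show ?thesis
    unfolding birkhoff_sum_def by (simp only: funpow_Suc_right o_apply)
qed

lemma abs_birkhoff_sum_le:
  assumes "\<And>\<omega>. \<omega> \<in> space M \<Longrightarrow> \<bar>h \<omega>\<bar> \<le> C" "\<omega> \<in> space M"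
  shows "\<bar>birkhoff_sum h k \<omega>\<bar> \<le> real k * C"
proof -
  have "\<bar>birkhoff_sum h k \<omega>\<bar> \<le> (\<Sum>i<k. \<bar>h ((S ^^ i) \<omega>)\<bar>)"
    unfolding birkhoff_sum_def by (rule sum_abs)
  also have "\<dots> \<le> (\<Sum>i<k. C)"
    by (intro sum_mono assms(1) funpow_space assms(2))
  finally show ?thesis by simp
qed

text \<open>Unfolded, \<open>running_max h n\<close> is the maximum of 0 and the Birkhoff sums of
  length 1 to \<open>n\<close>. The recursive form is the relation between consecutive lengths that
  the maximal lemma integrates.\<close>

primrec running_max :: "('a \<Rightarrow> real) \<Rightarrow> nat \<Rightarrow> 'a \<Rightarrow> real" where
  "running_max h 0 = (\<lambda>\<omega>. 0)"
| "running_max h (Suc n) = (\<lambda>\<omega>. max 0 (h \<omega> + running_max h n (S \<omega>)))"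

lemma running_max_measurable [measurable]:
  assumes [measurable]: "h \<in> borel_measurable M"
  shows "running_max h n \<in> borel_measurable M"
  by (induction n) auto

lemma running_max_nonneg: "0 \<le> running_max h n \<omega>"
  by (cases n) auto

lemma running_max_Suc_ge: "running_max h n \<omega> \<le> running_max h (Suc n) \<omega>"
proof (induction n arbitrary: \<omega>)
  case (Suc n)
  from Suc[of "S \<omega>"] show ?case by auto
qed simp

lemma running_max_mono: "m \<le> n \<Longrightarrow> running_max h m \<omega> \<le> running_max h n \<omega>"
  by (rule lift_Suc_mono_le[of "\<lambda>n. running_max h n \<omega>"]) (rule running_max_Suc_ge)

lemma birkhoff_sum_le_running_max: "birkhoff_sum h n \<omega> \<le> running_max h n \<omega>"
proof (induction n arbitrary: \<omega>)
  case (Suc n)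
  from Suc[of "S \<omega>"] show ?case unfolding birkhoff_sum_Suc by simp
qed (simp add: birkhoff_sum_def)

lemma running_max_le:
  assumes "\<And>\<omega>. \<omega> \<in> space M \<Longrightarrow> \<bar>h \<omega>\<bar> \<le> C" "\<omega> \<in> space M" "0 \<le> C"
  shows "running_max h n \<omega> \<le> real n * C"
  using assms(2)
proof (induction n arbitrary: \<omega>)
  case (Suc n)
  have "h \<omega> \<le> C" using assms(1)[OF Suc.prems] by simp
  moreover have "running_max h n (S \<omega>) \<le> real n * C"
    using Suc.prems by (intro Suc.IH) simp
  moreover have "0 \<le> real (Suc n) * C" using assms(3) by simp
  ultimately show ?case by (simp add: algebra_simps)
qed simp

text \<open>Garsia's argument: where \<open>running_max h (Suc n)\<close> is positive, it equals
  \<open>h\<close> plus \<open>running_max h n\<close> at \<open>S \<omega>\<close>; elsewhere its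
  difference from the latter is at most 0. Invariance and monotonicity in the length make the
  integral of this difference nonnegative. The alternative \<open>h \<omega> = 0\<close> admits
  functions cut off by an invariant set.\<close>

lemma integral_nonneg_of_positive_birkhoff_sum:
  assumes [measurable]: "h \<in> borel_measurable M"
    and bound: "\<And>\<omega>. \<omega> \<in> space M \<Longrightarrow> \<bar>h \<omega>\<bar> \<le> C"
    and ex: "\<And>\<omega>. \<omega> \<in> space M \<Longrightarrow> h \<omega> = 0 \<or> (\<exists>k. 0 < birkhoff_sum h k \<omega>)"
  shows "0 \<le> (\<integral>\<omega>. h \<omega> \<partial>M)"
proof -
  have C: "0 \<le> C"
    using not_empty by (meson abs_ge_zero all_not_in_conv bound order_trans)
  define A where "A n = {\<omega>\<in>space M. 0 < running_max h (Suc n) \<omega>}" for n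
  have [measurable]: "A n \<in> sets M" for n
    unfolding A_def by measurable
  have int_mx: "integrable M (running_max h n)" for n
  proof (rule integrable_const_bound[where B = "real n * C"])
    show "AE \<omega> in M. norm (running_max h n \<omega>) \<le> real n * C"
      using running_max_le[of h C, OF bound _ C] running_max_nonneg by (intro AE_I2) simp
  qed measurable
  have int_mxS: "integrable M (\<lambda>\<omega>. running_max h n (S \<omega>))" for n
  proof (rule integrable_const_bound[where B = "real n * C"])
    show "AE \<omega> in M. norm (running_max h n (S \<omega>)) \<le> real n * C"
      using running_max_le[of h C, OF bound _ C] running_max_nonneg by (intro AE_I2) simp
  qed measurable
  have bA: "\<bar>h \<omega> * indicator (A n) \<omega>\<bar> \<le> C" if "\<omega> \<in> space M" for n \<omega>
    using bound[OF that] C by (simp add: indicator_def)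
  have int_hA: "integrable M (\<lambda>\<omega>. h \<omega> * indicator (A n) \<omega>)" for n
  proof (rule integrable_const_bound[where B = C])
    show "AE \<omega> in M. norm (h \<omega> * indicator (A n) \<omega>) \<le> C"
      using bA by (intro AE_I2) simp
  qed measurable
  have nn: "0 \<le> (\<integral>\<omega>. h \<omega> * indicator (A n) \<omega> \<partial>M)" for n
  proof -
    have "0 \<le> (\<integral>\<omega>. running_max h (Suc n) \<omega> \<partial>M) - (\<integral>\<omega>. running_max h n \<omega> \<partial>M)"
      using integral_mono[OF int_mx int_mx, of n "Suc n"] running_max_Suc_ge by simp
    also have "\<dots> = (\<integral>\<omega>. running_max h (Suc n) \<omega> - running_max h n (S \<omega>) \<partial>M)"
      by (subst Bochner_Integration.integral_diff[OF int_mx int_mxS]) (simp only: integral_S running_max_measurable assms(1))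
    also have "\<dots> \<le> (\<integral>\<omega>. h \<omega> * indicator (A n) \<omega> \<partial>M)"
    proof (intro integral_mono Bochner_Integration.integrable_diff int_mx int_mxS int_hA)
      fix \<omega> assume "\<omega> \<in> space M"
      then show "running_max h (Suc n) \<omega> - running_max h n (S \<omega>) \<le> h \<omega> * indicator (A n) \<omega>"
        using running_max_nonneg[of h n "S \<omega>"] by (auto simp: A_def indicator_def)
    qed
    finally show ?thesis .
  qed
  have "(\<lambda>n. \<integral>\<omega>. h \<omega> * indicator (A n) \<omega> \<partial>M) \<longlonglongrightarrow> (\<integral>\<omega>. h \<omega> \<partial>M)"
  proof (rule integral_dominated_convergence[where w = "\<lambda>_. C"])
    show "AE \<omega> in M. (\<lambda>n. h \<omega> * indicator (A n) \<omega>) \<longlonglongrightarrow> h \<omega>"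
    proof (intro AE_I2)
      fix \<omega> assume \<omega>: "\<omega> \<in> space M"
      show "(\<lambda>n. h \<omega> * indicator (A n) \<omega>) \<longlonglongrightarrow> h \<omega>"
      proof (cases "h \<omega> = 0")
        case False
        then obtain k where k: "0 < birkhoff_sum h k \<omega>" using ex[OF \<omega>] by blast
        have "\<omega> \<in> A n" if "k \<le> n" for n
        proof -
          have "0 < running_max h k \<omega>"
            using k birkhoff_sum_le_running_max[of h k \<omega>] by linarith
          also have "\<dots> \<le> running_max h (Suc n) \<omega>"
            using that by (intro running_max_mono) simp
          finally show ?thesis unfolding A_def using \<omega> by blast
        qed
        then have "eventually (\<lambda>n. h \<omega> * indicator (A n) \<omega> = h \<omega>) sequentially"
          unfolding eventually_sequentially by (intro exI[of _ k]) (simp add: indicator_def)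
        then show ?thesis by (rule tendsto_eventually)
      qed simp
    qed
    show "AE \<omega> in M. norm (h \<omega> * indicator (A n) \<omega>) \<le> C" for n
      using bA by (intro AE_I2) simp
  qed auto
  then show ?thesis
    using nn by (intro LIMSEQ_le_const) auto
qed

section \<open>Almost sure convergence of Birkhoff averages of bounded functions\<close>

lemma birkhoff_average_shift:
  assumes bound: "\<And>\<omega>. \<omega> \<in> space M \<Longrightarrow> \<bar>g \<omega>\<bar> \<le> C" and \<omega>: "\<omega> \<in> space M"
  obtains d where "d \<longlonglongrightarrow> 0" "eventually (\<lambda>n. birkhoff_sum g n (S \<omega>) / real n
      = d n + birkhoff_sum g (n + 1) \<omega> / real (n + 1)) sequentially"
proof -
  define a where "a n = birkhoff_sum g (n + 1) \<omega> / real (n + 1)" for n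
  define d where "d n = (a n - g \<omega>) / real n" for n
  have a_le: "\<bar>a n\<bar> \<le> C" for n
    using abs_birkhoff_sum_le[of g C \<omega> "n + 1", OF bound \<omega>] unfolding a_def by (simp add: field_simps)
  have "d \<longlonglongrightarrow> 0"
  proof (rule Lim_null_comparison[of _ "\<lambda>n. 2 * C / real n"])
    show "eventually (\<lambda>n. norm (d n) \<le> 2 * C / real n) sequentially"
    proof (rule always_eventually, rule allI)
      fix n
      have "\<bar>a n - g \<omega>\<bar> \<le> 2 * C"
        using a_le[of n] bound[OF \<omega>] by linarith
      then show "norm (d n) \<le> 2 * C / real n"
        unfolding d_def by (simp add: divide_right_mono)
    qed
    show "(\<lambda>n. 2 * C / real n) \<longlonglongrightarrow> 0"
      by (rule lim_const_over_n)
  qed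
  moreover have "eventually (\<lambda>n. birkhoff_sum g n (S \<omega>) / real n = d n + a n) sequentially"
    using eventually_gt_at_top[of 0]
  proof eventually_elim
    case (elim n)
    have "real (n + 1) * a n = g \<omega> + birkhoff_sum g n (S \<omega>)"
      using birkhoff_sum_Suc[of g n \<omega>] unfolding a_def by (simp add: add.commute)
    then have "birkhoff_sum g n (S \<omega>) = real n * a n + (a n - g \<omega>)"
      by (simp add: algebra_simps)
    then show ?case using elim unfolding d_def by (simp add: add_divide_distrib)
  qed
  ultimately show ?thesis using that unfolding a_def by blast
qed

lemma limsup_birkhoff_average_invariant:
  assumes bound: "\<And>\<omega>. \<omega> \<in> space M \<Longrightarrow> \<bar>g \<omega>\<bar> \<le> C" and \<omega>: "\<omega> \<in> space M"
  shows "limsup (\<lambda>n. ereal (birkhoff_sum g n (S \<omega>) / real n))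
      = limsup (\<lambda>n. ereal (birkhoff_sum g n \<omega> / real n))"
    and "liminf (\<lambda>n. ereal (birkhoff_sum g n (S \<omega>) / real n))
      = liminf (\<lambda>n. ereal (birkhoff_sum g n \<omega> / real n))"
proof -
  obtain d where d: "d \<longlonglongrightarrow> 0" "eventually (\<lambda>n. birkhoff_sum g n (S \<omega>) / real n
      = d n + birkhoff_sum g (n + 1) \<omega> / real (n + 1)) sequentially"
    using birkhoff_average_shift[of g C \<omega>, OF bound \<omega>] by blast
  let ?v = "\<lambda>n. ereal (birkhoff_sum g n \<omega> / real n)"
  have ev: "eventually (\<lambda>n. ereal (birkhoff_sum g n (S \<omega>) / real n) = ereal (d n) + ?v (n + 1)) sequentially"
    using d(2) by eventually_elim simp
  have d': "(\<lambda>n. ereal (d n)) \<longlonglongrightarrow> 0"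
    using d(1) by (simp add: zero_ereal_def)
  show "limsup (\<lambda>n. ereal (birkhoff_sum g n (S \<omega>) / real n)) = limsup ?v"
    using Limsup_eq[OF ev] ereal_limsup_lim_add[OF d', of "\<lambda>n. ?v (n + 1)"] limsup_shift[of ?v] by simp
  show "liminf (\<lambda>n. ereal (birkhoff_sum g n (S \<omega>) / real n)) = liminf ?v"
    using Liminf_eq[OF ev] ereal_liminf_lim_add[OF d', of "\<lambda>n. ?v (n + 1)"] liminf_shift[of ?v] by simp
qed

text \<open>On the set \<open>D a b\<close>, where the averages oscillate across both levels, the
  maximal lemma applies to \<open>g - b\<close> and to \<open>a - g\<close> cut off to that set;
  adding the results shows that \<open>(a - b) * prob (D a b)\<close> is nonnegative. The limit is
  bounded on the whole space because it becomes the integrand for the next coordinate.\<close>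

theorem birkhoff:
  assumes g [measurable]: "g \<in> borel_measurable M"
    and bound: "\<And>\<omega>. \<omega> \<in> space M \<Longrightarrow> \<bar>g \<omega>\<bar> \<le> C"
  shows "\<exists>f. f \<in> borel_measurable M \<and> (\<forall>\<omega>\<in>space M. \<bar>f \<omega>\<bar> \<le> C) \<and>
    (AE \<omega> in M. (\<lambda>n. birkhoff_sum g n \<omega> / real n) \<longlonglongrightarrow> f \<omega>) \<and>
    (\<integral>\<omega>. f \<omega> \<partial>M) = (\<integral>\<omega>. g \<omega> \<partial>M)"
proof -
  have C: "0 \<le> C"
    using not_empty by (meson abs_ge_zero all_not_in_conv bound order_trans)
  define av where "av n \<omega> = birkhoff_sum g n \<omega> / real n" for n \<omega>
  have [measurable]: "av n \<in> borel_measurable M" for n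
    unfolding av_def by measurable
  have av_le: "\<bar>av n \<omega>\<bar> \<le> C" if "\<omega> \<in> space M" for n \<omega>
    using abs_birkhoff_sum_le[of g C \<omega> n, OF bound that] C
    by (cases "n = 0") (simp_all add: av_def field_simps)
  define D where "D a b = {\<omega>\<in>space M. ereal b < limsup (\<lambda>n. ereal (av n \<omega>))
      \<and> liminf (\<lambda>n. ereal (av n \<omega>)) < ereal a}" for a b
  have D_meas [measurable]: "D a b \<in> sets M" for a b
    unfolding D_def by measurable
  have D_S: "(S ^^ i) \<omega> \<in> D a b" if "\<omega> \<in> D a b" for i \<omega> a b
  proof (induction i)
    case (Suc i)
    have "(S ^^ i) \<omega> \<in> space M" using Suc unfolding D_def by blast
    then show ?case
      using Suc limsup_birkhoff_average_invariant[of g C "(S ^^ i) \<omega>", OF bound]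
      unfolding D_def av_def by simp
  qed (use that in simp)
  have D_null: "prob (D a b) = 0" if ab: "a < b" for a b
  proof -
    \<comment> \<open>Orbits that start in \<open>D a b\<close> stay there, so the cutoff is 1 along
      them. The pairs \<open>s = 1\<close>, \<open>t = b\<close> and \<open>s = - 1\<close>,
      \<open>t = - a\<close> give the two functions to be added.\<close>
    have bs: "birkhoff_sum (\<lambda>\<omega>. (s * g \<omega> - t) * indicator (D a b) \<omega>) k \<omega>
        = s * birkhoff_sum g k \<omega> - real k * t" if "\<omega> \<in> D a b" for \<omega> k s t
      using D_S[OF that] unfolding birkhoff_sum_def
      by (simp add: sum_subtractf sum_distrib_left)
    have meas: "(\<lambda>\<omega>. (s * g \<omega> - t) * indicator (D a b) \<omega>) \<in> borel_measurable M" for s t :: real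
      by measurable
    have bd: "\<bar>(s * g \<omega> - t) * indicator (D a b) \<omega>\<bar> \<le> \<bar>s\<bar> * C + \<bar>t\<bar>"
      if "\<omega> \<in> space M" for \<omega> s t
    proof -
      have "\<bar>s * g \<omega> - t\<bar> \<le> \<bar>s * g \<omega>\<bar> + \<bar>t\<bar>" by (rule abs_triangle_ineq4)
      also have "\<dots> \<le> \<bar>s\<bar> * C + \<bar>t\<bar>"
        using bound[OF that] by (simp add: abs_mult mult_left_mono)
      finally show ?thesis using C by (simp add: indicator_def)
    qed
    have int: "integrable M (\<lambda>\<omega>. (s * g \<omega> - t) * indicator (D a b) \<omega>)" for s t :: real
    proof (rule integrable_const_bound[where B = "\<bar>s\<bar> * C + \<bar>t\<bar>"])
      show "AE \<omega> in M. norm ((s * g \<omega> - t) * indicator (D a b) \<omega>) \<le> \<bar>s\<bar> * C + \<bar>t\<bar>"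
        using bd by (intro AE_I2) simp
    qed (rule meas)
    have up: "0 \<le> (\<integral>\<omega>. (1 * g \<omega> - b) * indicator (D a b) \<omega> \<partial>M)"
    proof (rule integral_nonneg_of_positive_birkhoff_sum[OF meas bd])
      fix \<omega> assume "\<omega> \<in> space M"
      show "(1 * g \<omega> - b) * indicator (D a b) \<omega> = 0
          \<or> (\<exists>k. 0 < birkhoff_sum (\<lambda>\<omega>. (1 * g \<omega> - b) * indicator (D a b) \<omega>) k \<omega>)"
      proof (cases "\<omega> \<in> D a b")
        case True
        have "\<exists>k>0. b < av k \<omega>"
        proof (rule ccontr)
          assume "\<not> ?thesis"
          then have "ereal (av k \<omega>) \<le> ereal b" if "0 < k" for k
            using that by (meson ereal_less_eq(3) not_le_imp_less)
          then have "eventually (\<lambda>k. ereal (av k \<omega>) \<le> ereal b) sequentially"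
            by (rule eventually_mono[OF eventually_gt_at_top[of 0]])
          then have "limsup (\<lambda>n. ereal (av n \<omega>)) \<le> ereal b" by (rule Limsup_bounded)
          with True show False unfolding D_def by auto
        qed
        then obtain k where "k > 0" "b < av k \<omega>" by blast
        then have "0 < 1 * birkhoff_sum g k \<omega> - real k * b"
          unfolding av_def by (simp add: field_simps)
        then show ?thesis unfolding bs[OF True, symmetric] by blast
      qed simp
    qed
    have lo: "0 \<le> (\<integral>\<omega>. (- 1 * g \<omega> - (- a)) * indicator (D a b) \<omega> \<partial>M)"
    proof (rule integral_nonneg_of_positive_birkhoff_sum[OF meas bd])
      fix \<omega> assume "\<omega> \<in> space M"
      show "(- 1 * g \<omega> - (- a)) * indicator (D a b) \<omega> = 0
          \<or> (\<exists>k. 0 < birkhoff_sum (\<lambda>\<omega>. (- 1 * g \<omega> - (- a)) * indicator (D a b) \<omega>) k \<omega>)"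
      proof (cases "\<omega> \<in> D a b")
        case True
        have "\<exists>k>0. av k \<omega> < a"
        proof (rule ccontr)
          assume "\<not> ?thesis"
          then have "ereal a \<le> ereal (av k \<omega>)" if "0 < k" for k
            using that by (meson ereal_less_eq(3) not_le_imp_less)
          then have "eventually (\<lambda>k. ereal a \<le> ereal (av k \<omega>)) sequentially"
            by (rule eventually_mono[OF eventually_gt_at_top[of 0]])
          then have "ereal a \<le> liminf (\<lambda>n. ereal (av n \<omega>))" by (rule Liminf_bounded)
          with True show False unfolding D_def by auto
        qed
        then obtain k where "k > 0" "av k \<omega> < a" by blast
        then have "0 < - 1 * birkhoff_sum g k \<omega> - real k * (- a)"
          unfolding av_def by (simp add: field_simps)
        then show ?thesis unfolding bs[OF True, symmetric] by blast
      qed simp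
    qed
    have "0 \<le> (\<integral>\<omega>. (1 * g \<omega> - b) * indicator (D a b) \<omega>
        + (- 1 * g \<omega> - (- a)) * indicator (D a b) \<omega> \<partial>M)"
      using up lo by (subst Bochner_Integration.integral_add[OF int int]) linarith
    also have "\<dots> = (\<integral>\<omega>. (a - b) * indicator (D a b) \<omega> \<partial>M)"
      by (intro Bochner_Integration.integral_cong refl) (simp add: left_diff_distrib)
    also have "\<dots> = (a - b) * prob (D a b)" by simp
    finally show ?thesis
      using ab measure_nonneg[of M "D a b"] unfolding zero_le_mult_iff by linarith
  qed
  have AE_D: "AE \<omega> in M. \<forall>p q::rat. p < q \<longrightarrow> \<omega> \<notin> D (of_rat p) (of_rat q)"
  proof -
    have null: "AE \<omega> in M. \<omega> \<notin> D (of_rat p) (of_rat q)" if "p < q" for p q :: rat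
      using D_null[of "of_rat p" "of_rat q"] that
      by (intro AE_not_in) (simp add: null_sets_def emeasure_eq_measure of_rat_less)
    show ?thesis
      unfolding AE_all_countable
    proof (intro allI)
      show "AE \<omega> in M. p < q \<longrightarrow> \<omega> \<notin> D (of_rat p) (of_rat q)" for p q :: rat
        using null[of p q] by (cases "p < q") auto
    qed
  qed
  have conv: "AE \<omega> in M. convergent (\<lambda>n. av n \<omega>)"
    using AE_D AE_space
  proof eventually_elim
    case (elim \<omega>)
    let ?L = "limsup (\<lambda>n. ereal (av n \<omega>))" and ?l = "liminf (\<lambda>n. ereal (av n \<omega>))"
    have "?L \<le> ?l"
    proof (rule ccontr)
      assume "\<not> ?thesis"
      then have "?l < ?L" by simp
      then obtain p where p: "?l < ereal (of_rat p)" "ereal (of_rat p) < ?L"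
        using ereal_dense3 by blast
      then obtain q where q: "ereal (of_rat p) < ereal (of_rat q)" "ereal (of_rat q) < ?L"
        using ereal_dense3 by blast
      have "\<omega> \<in> D (of_rat p) (of_rat q)" using p q elim(2) unfolding D_def by blast
      moreover have "p < q" using q(1) by (simp add: of_rat_less)
      ultimately show False using elim(1) by blast
    qed
    moreover have "?l \<le> ?L" by (rule Liminf_le_Limsup) simp
    ultimately have eq: "?l = ?L" by simp
    have "?L \<le> ereal C"
    proof (intro Limsup_bounded always_eventually allI)
      show "ereal (av n \<omega>) \<le> ereal C" for n
        using av_le[OF elim(2), of n] by simp
    qed
    moreover have "ereal (- C) \<le> ?l"
    proof (intro Liminf_bounded always_eventually allI)
      show "ereal (- C) \<le> ereal (av n \<omega>)" for n
        using av_le[OF elim(2), of n] by simp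
    qed
    ultimately obtain r where r: "?L = ereal r"
      using eq by (cases ?L) auto
    have "(\<lambda>n. av n \<omega>) \<longlonglongrightarrow> r"
      using eq r by (intro limsup_le_liminf_real) auto
    then show ?case by (auto simp: convergent_def)
  qed
  \<comment> \<open>\<open>lim\<close> is unspecified where the averages diverge; clamping yields
    the bound everywhere and changes nothing where they converge.\<close>
  define f where "f \<omega> = max (- C) (min C (lim (\<lambda>n. av n \<omega>)))" for \<omega>
  have f_meas [measurable]: "f \<in> borel_measurable M"
    unfolding f_def by measurable
  have f_le: "\<bar>f \<omega>\<bar> \<le> C" for \<omega>
    using C unfolding f_def by (auto simp: abs_le_iff)
  have AE_f: "AE \<omega> in M. (\<lambda>n. av n \<omega>) \<longlonglongrightarrow> f \<omega>"
    using conv AE_space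
  proof eventually_elim
    case (elim \<omega>)
    then have l: "(\<lambda>n. av n \<omega>) \<longlonglongrightarrow> lim (\<lambda>n. av n \<omega>)"
      by (simp add: convergent_LIMSEQ_iff)
    have *: "av n \<omega> \<le> C" "- C \<le> av n \<omega>" for n
      using av_le[OF elim(2), of n] by auto
    have "lim (\<lambda>n. av n \<omega>) \<le> C" "- C \<le> lim (\<lambda>n. av n \<omega>)"
      using LIMSEQ_le_const2[OF l, of C] LIMSEQ_le_const[OF l, of "- C"] * by auto
    then show ?case using l unfolding f_def by simp
  qed
  have "(\<lambda>n. \<integral>\<omega>. av n \<omega> \<partial>M) \<longlonglongrightarrow> (\<integral>\<omega>. f \<omega> \<partial>M)"
    using AE_f av_le by (intro integral_dominated_convergence[where w = "\<lambda>_. C"]) auto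
  moreover have "eventually (\<lambda>n. (\<integral>\<omega>. av n \<omega> \<partial>M) = (\<integral>\<omega>. g \<omega> \<partial>M)) sequentially"
    using eventually_gt_at_top[of 0]
  proof eventually_elim
    case (elim n)
    have "integrable M (\<lambda>\<omega>. g ((S ^^ i) \<omega>))" for i
    proof (rule integrable_const_bound[where B = C])
      show "AE \<omega> in M. norm (g ((S ^^ i) \<omega>)) \<le> C"
        using bound by (intro AE_I2) simp
    qed measurable
    then have "(\<integral>\<omega>. av n \<omega> \<partial>M) = (\<Sum>i<n. \<integral>\<omega>. g ((S ^^ i) \<omega>) \<partial>M) / real n"
      unfolding av_def birkhoff_sum_def by simp
    then show ?case using elim by (simp add: integral_funpow)
  qed
  then have "(\<lambda>n. \<integral>\<omega>. av n \<omega> \<partial>M) \<longlonglongrightarrow> (\<integral>\<omega>. g \<omega> \<partial>M)"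
    by (rule tendsto_eventually)
  ultimately have "(\<integral>\<omega>. f \<omega> \<partial>M) = (\<integral>\<omega>. g \<omega> \<partial>M)"
    by (rule LIMSEQ_unique)
  then show ?thesis
    using f_meas f_le AE_f unfolding av_def by blast
qed

end

section \<open>Averages over lattice boxes\<close>

context lattice_action
begin

lemma mp_map_T: "mp_map M (T p)"
  by unfold_locales (simp_all add: T_distr)

lemma funpow_T_axis:
  assumes \<omega>: "\<omega> \<in> space M"
  shows "(T (axis_pt i 1) ^^ k) \<omega> = T (axis_pt i k) \<omega>"
proof (induction k)
  case 0
  then show ?case using T_axis_zero[OF \<omega>] by simp
next
  case (Suc k)
  then show ?case using T_axis_add[OF \<omega>, of i 1 k] by simp
qed

lemma abs_box_sum_le:
  assumes bound: "\<And>\<omega>. \<omega> \<in> space M \<Longrightarrow> \<bar>g \<omega>\<bar> \<le> C" and \<omega>: "\<omega> \<in> space M"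
  shows "\<bar>box_sum g n \<omega>\<bar> \<le> (\<Prod>i\<in>UNIV. real (n i)) * C"
proof -
  have "\<bar>box_sum g n \<omega>\<bar> \<le> (\<Sum>x\<in>lbox n. \<bar>g (T x \<omega>)\<bar>)"
    unfolding box_sum_def by (rule sum_abs)
  also have "\<dots> \<le> (\<Sum>x\<in>lbox n. C)"
    by (intro sum_mono bound T_space \<omega>)
  finally show ?thesis by (simp add: card_lbox)
qed

text \<open>Markov's inequality for the infimum over \<open>p\<close>: on the event that all
  \<open>q p\<close> are at least \<open>1 / (k + 1)\<close>, every integral is at least the
  probability of that event divided by \<open>k + 1\<close>.\<close>

lemma AE_null_limit_of_integrals:
  fixes q :: "nat \<Rightarrow> 'a \<Rightarrow> real"
  assumes int: "\<And>p. integrable M (q p)" and nonneg: "\<And>p. AE \<omega> in M. 0 \<le> q p \<omega>"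
    and lim: "(\<lambda>p. \<integral>\<omega>. q p \<omega> \<partial>M) \<longlonglongrightarrow> 0"
  shows "AE \<omega> in M. \<forall>k::nat. \<exists>p. q p \<omega> < 1 / real (Suc k)"
  unfolding AE_all_countable
proof
  fix k :: nat
  have [measurable]: "q p \<in> borel_measurable M" for p
    using int by auto
  define Z where "Z = {\<omega>\<in>space M. \<forall>p. 1 / real (Suc k) \<le> q p \<omega>}"
  have Z [measurable]: "Z \<in> sets M" unfolding Z_def by measurable
  have "1 / real (Suc k) * prob Z \<le> (\<integral>\<omega>. q p \<omega> \<partial>M)" for p
  proof -
    have "1 / real (Suc k) * prob Z = (\<integral>\<omega>. 1 / real (Suc k) * indicator Z \<omega> \<partial>M)"
      using Z by simp
    also have "\<dots> \<le> (\<integral>\<omega>. q p \<omega> \<partial>M)"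
    proof (rule integral_mono_AE)
      show "AE \<omega> in M. 1 / real (Suc k) * indicator Z \<omega> \<le> q p \<omega>"
        using nonneg[of p] by eventually_elim (auto simp: Z_def indicator_def)
      show "integrable M (\<lambda>\<omega>. 1 / real (Suc k) * indicator Z \<omega>)"
        by (intro integrable_mult_right integrable_real_indicator Z) (simp add: emeasure_eq_measure)
    qed (rule int)
    finally show ?thesis .
  qed
  then have "1 / real (Suc k) * prob Z \<le> 0"
    by (intro LIMSEQ_le_const[OF lim]) auto
  then have "prob Z = 0"
    using measure_nonneg[of M Z] by (simp add: divide_le_0_iff)
  then have "AE \<omega> in M. \<omega> \<notin> Z"
    by (intro AE_not_in) (simp add: null_sets_def emeasure_eq_measure)
  then show "AE \<omega> in M. \<exists>p. q p \<omega> < 1 / real (Suc k)"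
    using AE_space by eventually_elim (auto simp: Z_def not_le)
qed

text \<open>
  Averages over boxes are iterated one-dimensional averages. For bounded functions the error
  committed in the inner average is dominated by functions decreasing to zero, so that each
  coordinate only needs the one-dimensional theorem.
\<close>
lemma box_average_convergence_step:
  assumes g [measurable]: "g \<in> borel_measurable M"
    and bound: "\<And>\<omega>. \<omega> \<in> space M \<Longrightarrow> \<bar>g \<omega>\<bar> \<le> C"
    and h [measurable]: "h \<in> borel_measurable M"
    and h_bound: "\<And>\<omega>. \<omega> \<in> space M \<Longrightarrow> \<bar>h \<omega>\<bar> \<le> C"
    and inner: "AE \<omega> in M. (\<lambda>j. box_sum g ((n j)(i := 1)) \<omega> / (\<Prod>l\<in>UNIV. real (((n j)(i := 1)) l)))
        \<longlonglongrightarrow> h \<omega>"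
    and outer: "AE \<omega> in M. (\<lambda>k. mp_map.birkhoff_sum (T (axis_pt i 1)) h k \<omega> / real k) \<longlonglongrightarrow> f \<omega>"
    and n: "filterlim (\<lambda>j. n j i) at_top sequentially"
  shows "AE \<omega> in M. (\<lambda>j. box_sum g (n j) \<omega> / (\<Prod>l\<in>UNIV. real (n j l))) \<longlonglongrightarrow> f \<omega>"
proof -
  interpret S: mp_map M "T (axis_pt i 1)" by (rule mp_map_T)
  have C: "0 \<le> C"
    using not_empty by (meson abs_ge_zero all_not_in_conv bound order_trans)
  \<comment> \<open>Average over the slice of the \<open>j\<close>-th box orthogonal to axis
    \<open>i\<close>. It tends to \<open>h\<close>, but it varies with \<open>j\<close>, so the
    outer average is not a Birkhoff average of one fixed function.\<close>
  define y where "y j \<omega> = box_sum g ((n j)(i := 1)) \<omega> / (\<Prod>l\<in>UNIV. real (((n j)(i := 1)) l))" for j \<omega>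
  have [measurable]: "y j \<in> borel_measurable M" for j
    unfolding y_def by measurable
  have y_le: "\<bar>y j \<omega>\<bar> \<le> C" if "\<omega> \<in> space M" for j \<omega>
  proof -
    have P: "0 \<le> (\<Prod>l\<in>UNIV. real (((n j)(i := 1)) l))" by (intro prod_nonneg) simp
    show ?thesis
    proof (cases "(\<Prod>l\<in>UNIV. real (((n j)(i := 1)) l)) = 0")
      case True
      then show ?thesis unfolding y_def True using C by simp
    next
      case False
      then have "0 < (\<Prod>l\<in>UNIV. real (((n j)(i := 1)) l))" using P by linarith
      then show ?thesis
        using abs_box_sum_le[of g C \<omega> "(n j)(i := 1)", OF bound that]
        unfolding y_def abs_divide by (simp only: pos_divide_le_eq abs_of_pos mult.commute)
    qed
  qed
  have avg: "box_sum g (n j) \<omega> / (\<Prod>l\<in>UNIV. real (n j l)) = S.birkhoff_sum (y j) (n j i) \<omega> / real (n j i)"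
    if \<omega>: "\<omega> \<in> space M" for j \<omega>
    unfolding S.birkhoff_sum_def funpow_T_axis[OF \<omega>] y_def
      box_sum_slices[OF \<omega>, of g "n j" i] prod_fun_upd_one[of "n j" i]
    by (simp only: sum_divide_distrib[symmetric] divide_divide_eq_left mult.commute)
  have diff_le: "\<bar>y j \<omega> - h \<omega>\<bar> \<le> 2 * C" if "\<omega> \<in> space M" for j \<omega>
    using y_le[OF that, of j] h_bound[OF that] by linarith
  \<comment> \<open>For fixed \<open>p\<close> this is one function that dominates the inner error
    for all \<open>j\<close> from \<open>p\<close> on, and Birkhoff's theorem applies to it.
    Boundedness keeps it below \<open>2 * C\<close>, so its integral tends to 0 with the inner
    error.\<close>
  define e where "e p \<omega> = (SUP j\<in>{p..}. \<bar>y j \<omega> - h \<omega>\<bar>)" for p \<omega>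
  have bdd: "bdd_above ((\<lambda>j. \<bar>y j \<omega> - h \<omega>\<bar>) ` A)" if "\<omega> \<in> space M" for \<omega> A
    using diff_le[OF that] by (intro bdd_aboveI[of _ "2 * C"]) auto
  have e_meas [measurable]: "e p \<in> borel_measurable M" for p
    unfolding e_def by (rule borel_measurable_cSUP) (use bdd in auto)
  have e_ge: "\<bar>y j \<omega> - h \<omega>\<bar> \<le> e p \<omega>" if "\<omega> \<in> space M" "p \<le> j" for p j \<omega>
    unfolding e_def using that by (intro cSUP_upper bdd) auto
  have e_nonneg: "0 \<le> e p \<omega>" if "\<omega> \<in> space M" for p \<omega>
    using e_ge[OF that, of p p] by linarith
  have e_le: "e p \<omega> \<le> 2 * C" if "\<omega> \<in> space M" for p \<omega>
    unfolding e_def by (intro cSUP_least diff_le that) auto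
  have e_abs: "\<bar>e p \<omega>\<bar> \<le> 2 * C" if "\<omega> \<in> space M" for p \<omega>
    using e_nonneg[OF that] e_le[OF that] by simp
  have e_lim: "AE \<omega> in M. (\<lambda>p. e p \<omega>) \<longlonglongrightarrow> 0"
    using inner AE_space
  proof eventually_elim
    case (elim \<omega>)
    show ?case
    proof (rule LIMSEQ_I)
      fix r :: real assume r: "0 < r"
      then have "0 < r / 2" by simp
      from LIMSEQ_D[OF elim(1) this] obtain N where N: "\<And>j. N \<le> j \<Longrightarrow> \<bar>y j \<omega> - h \<omega>\<bar> < r / 2"
        unfolding y_def real_norm_def by blast
      have "norm (e p \<omega> - 0) < r" if "N \<le> p" for p
      proof -
        have "e p \<omega> \<le> r / 2"
          unfolding e_def by (rule cSUP_least) (use N that in \<open>auto intro: less_imp_le order_trans\<close>)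
        then show ?thesis using e_nonneg[OF elim(2), of p] r by simp
      qed
      then show "\<exists>N. \<forall>p\<ge>N. norm (e p \<omega> - 0) < r" by blast
    qed
  qed
  define P where "P p q \<longleftrightarrow> q \<in> borel_measurable M \<and> (\<forall>\<omega>\<in>space M. \<bar>q \<omega>\<bar> \<le> 2 * C) \<and>
      (AE \<omega> in M. (\<lambda>k. S.birkhoff_sum (e p) k \<omega> / real k) \<longlonglongrightarrow> q \<omega>) \<and>
      (\<integral>\<omega>. q \<omega> \<partial>M) = (\<integral>\<omega>. e p \<omega> \<partial>M)" for p q
  have "\<exists>q. P p q" for p
    unfolding P_def by (rule S.birkhoff[of "e p" "2 * C", OF e_meas e_abs])
  then obtain q where q: "\<And>p. P p (q p)" by metis
  have q_meas: "\<And>p. q p \<in> borel_measurable M"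
    and q_le: "\<And>p \<omega>. \<omega> \<in> space M \<Longrightarrow> \<bar>q p \<omega>\<bar> \<le> 2 * C"
    and q_lim: "\<And>p. AE \<omega> in M. (\<lambda>k. S.birkhoff_sum (e p) k \<omega> / real k) \<longlonglongrightarrow> q p \<omega>"
    and q_int: "\<And>p. (\<integral>\<omega>. q p \<omega> \<partial>M) = (\<integral>\<omega>. e p \<omega> \<partial>M)"
    using q unfolding P_def by blast+
  have q_nonneg: "AE \<omega> in M. 0 \<le> q p \<omega>" for p
    using q_lim[of p] AE_space
  proof eventually_elim
    case (elim \<omega>)
    show ?case
    proof (rule LIMSEQ_le_const[OF elim(1)], intro exI allI impI)
      show "0 \<le> S.birkhoff_sum (e p) k \<omega> / real k" for k
        unfolding S.birkhoff_sum_def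
        by (intro divide_nonneg_nonneg sum_nonneg e_nonneg S.funpow_space elim(2)) simp
    qed
  qed
  have "(\<lambda>p. \<integral>\<omega>. e p \<omega> \<partial>M) \<longlonglongrightarrow> (\<integral>\<omega>. 0 \<partial>M)"
    using e_lim e_abs by (intro integral_dominated_convergence[where w = "\<lambda>_. 2 * C"]) auto
  then have q_int_lim: "(\<lambda>p. \<integral>\<omega>. q p \<omega> \<partial>M) \<longlonglongrightarrow> 0"
    unfolding q_int by simp
  have q_integrable: "integrable M (q p)" for p
    using q_le q_meas by (intro integrable_const_bound[where B = "2 * C"]) (auto intro: AE_I2)
  \<comment> \<open>The Birkhoff limit \<open>q p\<close> has the same mean as \<open>e p\<close>.
    Hence almost every point has a small \<open>q p\<close>, with an index \<open>p\<close> that may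
    depend on the point.\<close>
  have q_small: "AE \<omega> in M. \<forall>k::nat. \<exists>p. q p \<omega> < 1 / real (Suc k)"
    by (rule AE_null_limit_of_integrals[OF q_integrable q_nonneg q_int_lim])
  have q_lim': "AE \<omega> in M. \<forall>p. (\<lambda>k. S.birkhoff_sum (e p) k \<omega> / real k) \<longlonglongrightarrow> q p \<omega>"
    unfolding AE_all_countable using q_lim by blast
  show ?thesis
    using outer q_small q_lim' AE_space
  proof eventually_elim
    case (elim \<omega>)
    note \<omega> = elim(4)
    show ?case
    proof (rule LIMSEQ_I)
      fix r :: real assume r: "0 < r"
      then obtain k where k: "inverse (real (Suc k)) < r / 3"
        using reals_Archimedean[of "r / 3"] by auto
      obtain p where p: "q p \<omega> < r / 3"
        using elim(2)[rule_format, of k] k unfolding inverse_eq_divide by (blast intro: less_trans)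
      have 1: "eventually (\<lambda>j. S.birkhoff_sum (e p) (n j i) \<omega> / real (n j i) < q p \<omega> + r / 3) sequentially"
        using order_tendstoD(2)[OF filterlim_compose[OF elim(3)[rule_format, of p] n]] r by simp
      have 2: "eventually (\<lambda>j. \<bar>S.birkhoff_sum h (n j i) \<omega> / real (n j i) - f \<omega>\<bar> < r / 3) sequentially"
        using tendstoD[OF filterlim_compose[OF elim(1) n], of "r / 3"] r by (simp add: dist_real_def)
      have "eventually (\<lambda>j. norm (box_sum g (n j) \<omega> / (\<Prod>l\<in>UNIV. real (n j l)) - f \<omega>) < r) sequentially"
        using 1 2 eventually_ge_at_top[of p]
      proof eventually_elim
        case (elim j)
        have "\<bar>S.birkhoff_sum (y j) (n j i) \<omega> - S.birkhoff_sum h (n j i) \<omega>\<bar>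
            \<le> (\<Sum>k<n j i. \<bar>y j ((T (axis_pt i 1) ^^ k) \<omega>) - h ((T (axis_pt i 1) ^^ k) \<omega>)\<bar>)"
          unfolding S.birkhoff_sum_def sum_subtractf[symmetric] by (rule sum_abs)
        also have "\<dots> \<le> S.birkhoff_sum (e p) (n j i) \<omega>"
          unfolding S.birkhoff_sum_def by (intro sum_mono e_ge S.funpow_space \<omega> elim(3))
        finally have "\<bar>S.birkhoff_sum (y j) (n j i) \<omega> / real (n j i) - S.birkhoff_sum h (n j i) \<omega> / real (n j i)\<bar>
            \<le> S.birkhoff_sum (e p) (n j i) \<omega> / real (n j i)"
          unfolding diff_divide_distrib[symmetric] abs_divide by (simp add: divide_right_mono)
        then show ?case
          unfolding avg[OF \<omega>] real_norm_def using elim(1,2) p by linarith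
      qed
      then show "\<exists>N. \<forall>j\<ge>N. norm (box_sum g (n j) \<omega> / (\<Prod>l\<in>UNIV. real (n j l)) - f \<omega>) < r"
        by (simp only: eventually_sequentially)
    qed
  qed
qed

text \<open>The limit is fixed before the sequence of boxes, so that two roundings of the same boxes
  share it. In the induction \<open>S\<close> is the set of axes along which the boxes grow, all
  other sides being 1; for empty \<open>S\<close> the average is \<open>g\<close> itself.\<close>

theorem box_average_convergence:
  assumes g [measurable]: "g \<in> borel_measurable M"
    and bound: "\<And>\<omega>. \<omega> \<in> space M \<Longrightarrow> \<bar>g \<omega>\<bar> \<le> C"
  obtains f where "f \<in> borel_measurable M"
    "\<And>n. (\<And>i. filterlim (\<lambda>j. n j i) at_top sequentially) \<Longrightarrow>
      AE \<omega> in M. (\<lambda>j. box_sum g (n j) \<omega> / (\<Prod>i\<in>UNIV. real (n j i))) \<longlonglongrightarrow> f \<omega>"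
proof -
  have "finite S \<Longrightarrow> \<exists>f. f \<in> borel_measurable M \<and> (\<forall>\<omega>\<in>space M. \<bar>f \<omega>\<bar> \<le> C) \<and>
      (\<forall>n. (\<forall>j. \<forall>i. i \<notin> S \<longrightarrow> n j i = 1) \<longrightarrow> (\<forall>i\<in>S. filterlim (\<lambda>j. n j i) at_top sequentially) \<longrightarrow>
        (AE \<omega> in M. (\<lambda>j. box_sum g (n j) \<omega> / (\<Prod>i\<in>UNIV. real (n j i))) \<longlonglongrightarrow> f \<omega>))" for S
  proof (induction S rule: finite_induct)
    case empty
    show ?case
    proof (intro exI[of _ g] conjI allI impI g ballI bound)
      fix n :: "nat \<Rightarrow> 'n \<Rightarrow> nat"
      assume "\<forall>j i. i \<notin> {} \<longrightarrow> n j i = 1"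
      then have n: "n j = (\<lambda>_. 1)" for j by auto
      have one: "lbox (\<lambda>_::'n. 1::nat) = {\<lambda>_. 0}"
        by (auto simp: lbox_def)
      show "AE \<omega> in M. (\<lambda>j. box_sum g (n j) \<omega> / (\<Prod>i\<in>UNIV. real (n j i))) \<longlonglongrightarrow> g \<omega>"
        unfolding n box_sum_def one using T_zero by (intro AE_I2) simp
    qed
  next
    case (insert i S)
    then obtain h where h: "h \<in> borel_measurable M" "\<And>\<omega>. \<omega> \<in> space M \<Longrightarrow> \<bar>h \<omega>\<bar> \<le> C"
      and h_lim: "\<And>n. \<forall>j. \<forall>i. i \<notin> S \<longrightarrow> n j i = 1 \<Longrightarrow>
        \<forall>i\<in>S. filterlim (\<lambda>j. n j i) at_top sequentially \<Longrightarrow>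
        AE \<omega> in M. (\<lambda>j. box_sum g (n j) \<omega> / (\<Prod>i\<in>UNIV. real (n j i))) \<longlonglongrightarrow> h \<omega>"
      by blast
    interpret S: mp_map M "T (axis_pt i 1)" by (rule mp_map_T)
    obtain f where f: "f \<in> borel_measurable M" "\<forall>\<omega>\<in>space M. \<bar>f \<omega>\<bar> \<le> C"
      "AE \<omega> in M. (\<lambda>k. S.birkhoff_sum h k \<omega> / real k) \<longlonglongrightarrow> f \<omega>"
      using S.birkhoff[of h C, OF h] by blast
    show ?case
    proof (intro exI[of _ f] conjI allI impI f(1,2))
      fix n :: "nat \<Rightarrow> 'n \<Rightarrow> nat"
      assume n1: "\<forall>j l. l \<notin> insert i S \<longrightarrow> n j l = 1"
        and n2: "\<forall>l\<in>insert i S. filterlim (\<lambda>j. n j l) at_top sequentially"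
      show "AE \<omega> in M. (\<lambda>j. box_sum g (n j) \<omega> / (\<Prod>i\<in>UNIV. real (n j i))) \<longlonglongrightarrow> f \<omega>"
      proof (rule box_average_convergence_step[OF g _ h(1) _ _ f(3)])
        show "\<bar>g \<omega>\<bar> \<le> C" "\<bar>h \<omega>\<bar> \<le> C" if "\<omega> \<in> space M" for \<omega>
          using that bound h(2) by blast+
        show "filterlim (\<lambda>j. n j i) at_top sequentially" using n2 by blast
        show "AE \<omega> in M. (\<lambda>j. box_sum g ((n j)(i := 1)) \<omega> / (\<Prod>l\<in>UNIV. real (((n j)(i := 1)) l)))
          \<longlonglongrightarrow> h \<omega>"
        proof (rule h_lim)
          show "\<forall>j l. l \<notin> S \<longrightarrow> ((n j)(i := 1)) l = 1" using n1 by simp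
          show "\<forall>l\<in>S. filterlim (\<lambda>j. ((n j)(i := 1)) l) at_top sequentially"
          proof
            fix l assume "l \<in> S"
            then have "l \<noteq> i" using insert.hyps(2) by blast
            with \<open>l \<in> S\<close> n2 show "filterlim (\<lambda>j. ((n j)(i := 1)) l) at_top sequentially"
              by simp
          qed
        qed
      qed
    qed
  qed
  from this[of UNIV] obtain f where "f \<in> borel_measurable M"
    "\<forall>n. (\<forall>i. filterlim (\<lambda>j. n j i) at_top sequentially) \<longrightarrow>
      (AE \<omega> in M. (\<lambda>j. box_sum g (n j) \<omega> / (\<Prod>i\<in>UNIV. real (n j i))) \<longlonglongrightarrow> f \<omega>)"
    by auto
  then show ?thesis using that by blast
qed

end

section \<open>Cubes and their subadditivity\<close>

definition vec_upd :: "real ^ 'n \<Rightarrow> 'n \<Rightarrow> real \<Rightarrow> real ^ 'n" where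
  "vec_upd a i t = (\<chi> j. if j = i then t else a $ j)"

lemma vec_upd_nth [simp]: "vec_upd a i t $ j = (if j = i then t else a $ j)"
  by (simp add: vec_upd_def)

lemma half_open_box_measurable [measurable]:
  fixes a b :: "real ^ 'n"
  shows "half_open_box a b \<in> sets borel"
proof -
  have "half_open_box a b = (\<Inter>i. {x. a $ i \<le> x $ i} \<inter> {x. x $ i < b $ i})"
    by (auto simp: half_open_box_def)
  moreover have "closed {x :: real ^ 'n. a $ i \<le> x $ i}" "open {x :: real ^ 'n. x $ i < b $ i}" for i
    by (intro closed_Collect_le open_Collect_less continuous_intros)+
  ultimately show ?thesis
    by (auto intro!: sets.finite_INT)
qed

lemma vol_half_open_box:
  assumes "\<And>i. a $ i \<le> b $ i"
  shows "vol (half_open_box a b) = (\<Prod>i\<in>UNIV. b $ i - a $ i)"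
proof -
  have sub: "box a b \<subseteq> half_open_box a b" "half_open_box a b \<subseteq> cbox a b"
    by (auto simp: half_open_box_def mem_box_cart less_imp_le)
  have "half_open_box a b \<in> fmeasurable lborel"
    by (rule fmeasurableI2[OF fmeasurable_cbox sub(2)]) simp
  then have "measure lborel (box a b) \<le> vol (half_open_box a b)"
    "vol (half_open_box a b) \<le> measure lborel (cbox a b)"
    by (intro measure_mono_fmeasurable sub fmeasurable_cbox; simp)+
  moreover have "measure lborel (box a b) = measure lborel (cbox a b)"
    unfolding measure_lborel_box_eq measure_lborel_cbox_eq ..
  moreover have "measure lborel (cbox a b) = (\<Prod>i\<in>UNIV. b $ i - a $ i)"
    using assms by (intro content_cbox_cart) (simp add: interval_ne_empty_cart)
  ultimately show ?thesis by simp
qed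

lemma vol_pos:
  assumes "\<And>i. a $ i < b $ i"
  shows "0 < vol (half_open_box a b)"
  using assms by (subst vol_half_open_box) (auto intro!: prod_pos less_imp_le)

lemma vol_split:
  assumes "\<And>j. a $ j \<le> b $ j" "a $ i \<le> t" "t \<le> b $ i"
  shows "vol (half_open_box a b)
    = vol (half_open_box a (vec_upd b i t)) + vol (half_open_box (vec_upd a i t) b)"
proof -
  have 1: "vol (half_open_box a b) = (b $ i - a $ i) * (\<Prod>j\<in>UNIV - {i}. b $ j - a $ j)"
    using assms by (subst vol_half_open_box) (auto simp: prod.remove[of _ i])
  have 2: "vol (half_open_box a (vec_upd b i t)) = (t - a $ i) * (\<Prod>j\<in>UNIV - {i}. b $ j - a $ j)"
    using assms by (subst vol_half_open_box) (auto simp: prod.remove[of _ i])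
  have 3: "vol (half_open_box (vec_upd a i t) b) = (b $ i - t) * (\<Prod>j\<in>UNIV - {i}. b $ j - a $ j)"
    using assms by (subst vol_half_open_box) (auto simp: prod.remove[of _ i])
  show ?thesis unfolding 1 2 3 by (simp add: algebra_simps)
qed

lemma translate_half_open_box: "(+) s ` half_open_box a b = half_open_box (s + a) (s + b)"
proof (intro set_eqI iffI)
  fix x assume "x \<in> half_open_box (s + a) (s + b)"
  then have "x - s \<in> half_open_box a b"
    by (simp add: half_open_box_def algebra_simps)
  then show "x \<in> (+) s ` half_open_box a b"
    by (intro image_eqI[of _ _ "x - s"]) simp_all
qed (auto simp: half_open_box_def)

lemma half_open_box_in_cubes: "(\<And>i. a $ i < b $ i) \<Longrightarrow> half_open_box a b \<in> cubes"
  unfolding cubes_def by blast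

lemma corner_cube_in_cubes: "(\<And>i. 0 < u $ i) \<Longrightarrow> corner_cube u \<in> cubes"
  unfolding corner_cube_def by (rule half_open_box_in_cubes) simp

lemma vol_corner_cube: "(\<And>i. 0 < u $ i) \<Longrightarrow> vol (corner_cube u) = (\<Prod>i\<in>UNIV. u $ i)"
  unfolding corner_cube_def by (subst vol_half_open_box) (auto intro: less_imp_le)

lemma vol_corner_cube_pos: "(\<And>i. 0 < u $ i) \<Longrightarrow> 0 < vol (corner_cube u)"
  unfolding corner_cube_def by (rule vol_pos) simp

section \<open>Consequences of stationarity, subadditivity and the volume bound\<close>

locale subadditive_cube_process = prob_space M for M :: "'a measure" +
  fixes \<tau> :: "real ^ 'n \<Rightarrow> 'a \<Rightarrow> 'a" and R :: "(real ^ 'n) set \<Rightarrow> 'a \<Rightarrow> real" and C :: real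
  assumes group: "mp_group M \<tau>" and process: "cube_process M R" and stat: "stationary M \<tau> R"
    and subadd: "cube_subadditive M R"
    and R_bound: "\<And>\<omega> I. \<omega> \<in> space M \<Longrightarrow> I \<in> cubes \<Longrightarrow> 0 \<le> R I \<omega> \<and> R I \<omega> \<le> C * vol I"
begin

abbreviation \<gamma> :: real where "\<gamma> \<equiv> spatial_constant M R"

lemma tau_measurable [measurable]: "\<tau> s \<in> measurable M M"
  using group unfolding mp_group_def by blast

lemma tau_distr: "distr M M (\<tau> s) = M"
  using group unfolding mp_group_def by blast

lemma tau_zero: "\<omega> \<in> space M \<Longrightarrow> \<tau> 0 \<omega> = \<omega>"
  using group unfolding mp_group_def by blast

lemma tau_add: "\<omega> \<in> space M \<Longrightarrow> \<tau> (s + t) \<omega> = \<tau> s (\<tau> t \<omega>)"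
  using group unfolding mp_group_def by blast

lemma tau_space: "\<omega> \<in> space M \<Longrightarrow> \<tau> s \<omega> \<in> space M"
  by (rule measurable_space[OF tau_measurable])

lemma R_measurable: "I \<in> cubes \<Longrightarrow> R I \<in> borel_measurable M"
  using process unfolding cube_process_def by blast

lemma R_integrable: "I \<in> cubes \<Longrightarrow> integrable M (R I)"
  using R_bound by (intro integrable_const_bound[where B = "C * vol I"] AE_I2 R_measurable) auto

lemma R_translate:
  assumes "\<And>i. a $ i < b $ i" "\<omega> \<in> space M"
  shows "R (half_open_box (s + a) (s + b)) \<omega> = R (half_open_box a b) (\<tau> s \<omega>)"
  using stat half_open_box_in_cubes[OF assms(1)] assms(2)
  unfolding stationary_def translate_half_open_box[symmetric] by blast

lemma integral_tau:
  fixes f :: "'a \<Rightarrow> real"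
  assumes [measurable]: "f \<in> borel_measurable M"
  shows "(\<integral>\<omega>. f (\<tau> s \<omega>) \<partial>M) = (\<integral>\<omega>. f \<omega> \<partial>M)"
  by (subst (2) tau_distr[of s, symmetric]) (simp add: integral_distr)

lemma R_cut:
  assumes \<omega>: "\<omega> \<in> space M" and ab: "\<And>j. a $ j < b $ j" and t: "a $ i < t" "t < b $ i"
  shows "R (half_open_box a b) \<omega>
    \<le> R (half_open_box a (vec_upd b i t)) \<omega> + R (half_open_box (vec_upd a i t) b) \<omega>"
proof -
  let ?I1 = "half_open_box a (vec_upd b i t)" and ?I2 = "half_open_box (vec_upd a i t) b"
  have Un: "half_open_box a b = ?I1 \<union> ?I2"
  proof (intro set_eqI iffI)
    fix x assume x: "x \<in> half_open_box a b"
    show "x \<in> ?I1 \<union> ?I2"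
    proof (cases "x $ i < t")
      case True
      then have "x \<in> ?I1" using x unfolding half_open_box_def by simp
      then show ?thesis ..
    next
      case False
      then have "x \<in> ?I2" using x unfolding half_open_box_def by simp
      then show ?thesis ..
    qed
  next
    fix x assume "x \<in> ?I1 \<union> ?I2"
    then show "x \<in> half_open_box a b"
    proof
      assume x: "x \<in> ?I1"
      have "a $ j \<le> x $ j \<and> x $ j < b $ j" for j
        using x t unfolding half_open_box_def by (cases "j = i") (auto dest!: spec[of _ j])
      then show ?thesis unfolding half_open_box_def by blast
    next
      assume x: "x \<in> ?I2"
      have "a $ j \<le> x $ j \<and> x $ j < b $ j" for j
        using x t unfolding half_open_box_def by (cases "j = i") (auto dest!: spec[of _ j])
      then show ?thesis unfolding half_open_box_def by blast
    qed
  qed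
  have dis: "?I1 \<inter> ?I2 = {}"
  proof (rule equals0I)
    fix x assume "x \<in> ?I1 \<inter> ?I2"
    then have "x $ i < vec_upd b i t $ i" "vec_upd a i t $ i \<le> x $ i"
      unfolding half_open_box_def by blast+
    then show False by simp
  qed
  have c: "half_open_box a b \<in> cubes" "?I1 \<in> cubes" "?I2 \<in> cubes"
    using ab t by (auto intro!: half_open_box_in_cubes)
  show ?thesis
    using subadd[unfolded cube_subadditive_def, rule_format, OF c Un dis \<omega>] .
qed

text \<open>The piece cut off contributes at most \<open>C\<close> times its volume, so
  \<open>R - C * vol\<close> can only grow when a face moves inwards. In this form the estimates
  telescope over the faces.\<close>

lemma R_shrink_upper:
  assumes \<omega>: "\<omega> \<in> space M" and ab: "\<And>j. a $ j < b $ j" and t: "a $ i < t" "t \<le> b $ i"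
  shows "R (half_open_box a b) \<omega> - C * vol (half_open_box a b)
    \<le> R (half_open_box a (vec_upd b i t)) \<omega> - C * vol (half_open_box a (vec_upd b i t))"
proof (cases "t = b $ i")
  case True
  then have "vec_upd b i t = b" by (simp add: vec_eq_iff)
  then show ?thesis by simp
next
  case False
  with t have tb: "t < b $ i" by simp
  have "half_open_box (vec_upd a i t) b \<in> cubes"
    using ab tb by (intro half_open_box_in_cubes) simp
  then have "R (half_open_box (vec_upd a i t) b) \<omega> \<le> C * vol (half_open_box (vec_upd a i t) b)"
    using R_bound[OF \<omega>] by blast
  moreover have "C * vol (half_open_box a b)
    = C * vol (half_open_box a (vec_upd b i t)) + C * vol (half_open_box (vec_upd a i t) b)"
    using ab t by (subst vol_split[of a b i t]) (auto intro: less_imp_le simp: distrib_left)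
  ultimately show ?thesis using R_cut[of \<omega> a b i t, OF \<omega> ab t(1) tb] by linarith
qed

lemma R_shrink_lower:
  assumes \<omega>: "\<omega> \<in> space M" and ab: "\<And>j. a $ j < b $ j" and t: "a $ i \<le> t" "t < b $ i"
  shows "R (half_open_box a b) \<omega> - C * vol (half_open_box a b)
    \<le> R (half_open_box (vec_upd a i t) b) \<omega> - C * vol (half_open_box (vec_upd a i t) b)"
proof (cases "t = a $ i")
  case True
  then have "vec_upd a i t = a" by (simp add: vec_eq_iff)
  then show ?thesis by simp
next
  case False
  with t have ta: "a $ i < t" by simp
  have "half_open_box a (vec_upd b i t) \<in> cubes"
    using ab ta by (intro half_open_box_in_cubes) simp
  then have "R (half_open_box a (vec_upd b i t)) \<omega> \<le> C * vol (half_open_box a (vec_upd b i t))"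
    using R_bound[OF \<omega>] by blast
  moreover have "C * vol (half_open_box a b)
    = C * vol (half_open_box a (vec_upd b i t)) + C * vol (half_open_box (vec_upd a i t) b)"
    using ab t by (subst vol_split[of a b i t]) (auto intro: less_imp_le simp: distrib_left)
  ultimately show ?thesis using R_cut[of \<omega> a b i t, OF \<omega> ab ta t(2)] by linarith
qed

text \<open>The one-sided comparison of nested boxes: the larger is controlled by the smaller.
  Corners move one axis at a time, \<open>\<alpha> S\<close> and \<open>\<beta> S\<close> being
  their positions once the axes in \<open>S\<close> are done.\<close>

lemma R_subbox:
  assumes \<omega>: "\<omega> \<in> space M"
    and le: "\<And>j. a $ j \<le> a' $ j" "\<And>j. a' $ j < b' $ j" "\<And>j. b' $ j \<le> b $ j"
  shows "R (half_open_box a b) \<omega>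
    \<le> R (half_open_box a' b') \<omega> + C * (vol (half_open_box a b) - vol (half_open_box a' b'))"
proof -
  define \<alpha> where "\<alpha> S = (\<chi> j. if j \<in> S then a' $ j else a $ j)" for S
  define \<beta> where "\<beta> S = (\<chi> j. if j \<in> S then b' $ j else b $ j)" for S
  have ab: "a $ j < b $ j" "a $ j < b' $ j" "a' $ j < b $ j" for j
    using le(1-3)[of j] by linarith+
  have lt: "\<alpha> S $ j < \<beta> S $ j" for S j
    using ab[of j] le(2)[of j] by (simp add: \<alpha>_def \<beta>_def)
  have "finite S \<Longrightarrow> R (half_open_box a b) \<omega> - C * vol (half_open_box a b)
      \<le> R (half_open_box (\<alpha> S) (\<beta> S)) \<omega> - C * vol (half_open_box (\<alpha> S) (\<beta> S))" for S
  proof (induction S rule: finite_induct)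
    case empty
    have "\<alpha> {} = a" "\<beta> {} = b" by (simp_all add: \<alpha>_def \<beta>_def vec_eq_iff)
    then show ?case by simp
  next
    case (insert i S)
    have \<alpha>i: "\<alpha> (insert i S) = vec_upd (\<alpha> S) i (a' $ i)" and \<beta>i: "\<beta> (insert i S) = vec_upd (\<beta> S) i (b' $ i)"
      by (simp_all add: \<alpha>_def \<beta>_def vec_eq_iff)
    have S: "\<alpha> S $ i = a $ i" "\<beta> S $ i = b $ i"
      using insert.hyps by (simp_all add: \<alpha>_def \<beta>_def)
    note insert.IH
    also have "R (half_open_box (\<alpha> S) (\<beta> S)) \<omega> - C * vol (half_open_box (\<alpha> S) (\<beta> S))
        \<le> R (half_open_box (\<alpha> S) (vec_upd (\<beta> S) i (b' $ i))) \<omega>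
          - C * vol (half_open_box (\<alpha> S) (vec_upd (\<beta> S) i (b' $ i)))"
      using ab(2)[of i] le(3)[of i] lt by (intro R_shrink_upper \<omega>) (simp_all add: S)
    also have "\<dots> \<le> R (half_open_box (\<alpha> (insert i S)) (\<beta> (insert i S))) \<omega>
          - C * vol (half_open_box (\<alpha> (insert i S)) (\<beta> (insert i S)))"
      unfolding \<alpha>i \<beta>i using ab(2)[of i] le[of i] lt
      by (intro R_shrink_lower \<omega>) (simp_all add: S)
    finally show ?case .
  qed
  from this[of UNIV] have "R (half_open_box a b) \<omega> - C * vol (half_open_box a b)
      \<le> R (half_open_box (\<alpha> UNIV) (\<beta> UNIV)) \<omega> - C * vol (half_open_box (\<alpha> UNIV) (\<beta> UNIV))"
    by simp
  moreover have "\<alpha> UNIV = a'" "\<beta> UNIV = b'" by (simp_all add: \<alpha>_def \<beta>_def vec_eq_iff)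
  ultimately show ?thesis by (simp add: right_diff_distrib)
qed

lemma R_corner_subbox:
  assumes "\<omega> \<in> space M" "\<And>j. 0 < v $ j" "\<And>j. v $ j \<le> u $ j"
  shows "R (corner_cube u) \<omega>
    \<le> R (corner_cube v) \<omega> + C * (vol (corner_cube u) - vol (corner_cube v))"
  unfolding corner_cube_def using assms by (intro R_subbox) auto

lemma C_nonneg: "0 \<le> C"
proof -
  obtain \<omega> where \<omega>: "\<omega> \<in> space M" using not_empty by blast
  have "0 \<le> C * vol (corner_cube (1 :: real ^ 'n))"
    using R_bound[OF \<omega> corner_cube_in_cubes[of 1]] by simp
  then show ?thesis
    using vol_corner_cube_pos[of "1 :: real ^ 'n"] by (simp add: zero_le_mult_iff)
qed

lemma integral_R_nonneg: "K \<in> cubes \<Longrightarrow> 0 \<le> (\<integral>\<omega>. R K \<omega> \<partial>M)"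
  using R_bound by (intro integral_nonneg_AE AE_I2) auto

lemma spatial_constant_le:
  assumes "\<And>i. 0 < u $ i"
  shows "\<gamma> * vol (corner_cube u) \<le> (\<integral>\<omega>. R (corner_cube u) \<omega> \<partial>M)"
proof -
  have "bdd_below ((\<lambda>K. 1 / vol K * (\<integral>\<omega>. R K \<omega> \<partial>M)) ` cubes)"
    by (intro bdd_belowI[of _ 0]) (auto intro!: divide_nonneg_nonneg integral_R_nonneg)
  then have "\<gamma> \<le> 1 / vol (corner_cube u) * (\<integral>\<omega>. R (corner_cube u) \<omega> \<partial>M)"
    unfolding spatial_constant_def by (intro cINF_lower corner_cube_in_cubes assms)
  then show ?thesis
    using vol_corner_cube_pos[of u, OF assms] by (simp add: field_simps)
qed

text \<open>The infimum runs over all cubes, but stationarity moves a nearly optimal one to the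
  origin without changing its mean.\<close>

lemma spatial_constant_approx:
  assumes "\<gamma> < c"
  obtains \<kappa> :: "real ^ 'n" where "\<And>i. 0 < \<kappa> $ i"
    "(\<integral>\<omega>. R (corner_cube \<kappa>) \<omega> \<partial>M) < c * vol (corner_cube \<kappa>)"
proof -
  have ne: "(cubes :: (real ^ 'n) set set) \<noteq> {}"
    using corner_cube_in_cubes[of 1] by auto
  obtain K :: "(real ^ 'n) set" where K: "K \<in> cubes" "1 / vol K * (\<integral>\<omega>. R K \<omega> \<partial>M) < c"
    using cInf_lessD[of "(\<lambda>K. 1 / vol K * (\<integral>\<omega>. R K \<omega> \<partial>M)) ` cubes" c] assms ne
    unfolding spatial_constant_def by auto
  then obtain a b where ab: "K = half_open_box a b" "\<And>i. a $ i < b $ i"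
    unfolding cubes_def by auto
  define \<kappa> where "\<kappa> = b - a"
  have \<kappa>: "0 < \<kappa> $ i" for i using ab(2)[of i] by (simp add: \<kappa>_def)
  have vol: "vol K = vol (corner_cube \<kappa>)"
    unfolding vol_corner_cube[of \<kappa>, OF \<kappa>] ab(1)
    using ab(2) by (subst vol_half_open_box) (auto intro: less_imp_le simp: \<kappa>_def)
  have "R K \<omega> = R (corner_cube \<kappa>) (\<tau> a \<omega>)" if "\<omega> \<in> space M" for \<omega>
    using R_translate[of 0 \<kappa> \<omega> a] \<kappa> that unfolding ab(1) corner_cube_def by (simp add: \<kappa>_def)
  then have "(\<integral>\<omega>. R K \<omega> \<partial>M) = (\<integral>\<omega>. R (corner_cube \<kappa>) (\<tau> a \<omega>) \<partial>M)"
    by (intro Bochner_Integration.integral_cong) auto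
  also have "\<dots> = (\<integral>\<omega>. R (corner_cube \<kappa>) \<omega> \<partial>M)"
    by (intro integral_tau R_measurable corner_cube_in_cubes \<kappa>)
  finally have "(\<integral>\<omega>. R (corner_cube \<kappa>) \<omega> \<partial>M) < c * vol (corner_cube \<kappa>)"
    using K(2) vol_corner_cube_pos[of \<kappa>, OF \<kappa>] unfolding vol by (simp add: field_simps)
  with \<kappa> show ?thesis by (rule that)
qed

end

section \<open>Comparison with tile sums\<close>

definition grid_pt :: "real ^ 'n \<Rightarrow> ('n \<Rightarrow> nat) \<Rightarrow> real ^ 'n" where
  "grid_pt \<kappa> p = (\<chi> i. real (p i) * \<kappa> $ i)"

lemma grid_pt_nth [simp]: "grid_pt \<kappa> p $ i = real (p i) * \<kappa> $ i"
  by (simp add: grid_pt_def)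

lemma grid_pt_add: "grid_pt \<kappa> (\<lambda>i. p i + q i) = grid_pt \<kappa> p + grid_pt \<kappa> q"
  by (simp add: vec_eq_iff algebra_simps)

lemma grid_pt_zero: "grid_pt \<kappa> (\<lambda>_. 0) = 0"
  by (simp add: vec_eq_iff)

lemma vol_grid_cube:
  assumes "\<And>i. 0 < \<kappa> $ i" "\<And>i. 0 < n i"
  shows "vol (corner_cube (grid_pt \<kappa> n)) = (\<Prod>i\<in>UNIV. real (n i)) * vol (corner_cube \<kappa>)"
  using assms by (simp add: vol_corner_cube prod.distrib)

text \<open>\<open>n\<close> is any rounding of \<open>u / \<kappa>\<close> with error at most 1, so
  floor and ceiling are treated together. The relative error in coordinate \<open>i\<close> is at
  most \<open>\<kappa> $ i / u j $ i\<close>, which tends to 0.\<close>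

lemma grid_approximation:
  fixes u :: "nat \<Rightarrow> real ^ 'n"
  assumes \<kappa>: "\<And>i. 0 < \<kappa> $ i" and u: "\<And>j i. 0 < u j $ i"
    and u_lim: "\<And>i. filterlim (\<lambda>j. u j $ i) at_top sequentially"
    and n: "\<And>j i. \<bar>real (n j i) - u j $ i / \<kappa> $ i\<bar> \<le> 1"
  shows "filterlim (\<lambda>j. n j i) at_top sequentially"
    and "(\<lambda>j. (\<Prod>i\<in>UNIV. real (n j i)) * vol (corner_cube \<kappa>) / vol (corner_cube (u j))) \<longlonglongrightarrow> 1"
proof -
  have "filterlim (\<lambda>j. real (n j i)) at_top sequentially"
  proof (rule filterlim_at_top_mono)
    show "filterlim (\<lambda>j. - 1 + u j $ i * (1 / \<kappa> $ i)) at_top sequentially"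
      using \<kappa>[of i] by (intro filterlim_tendsto_add_at_top[OF tendsto_const]
          filterlim_at_top_mult_tendsto_pos[OF tendsto_const _ u_lim]) simp
    show "eventually (\<lambda>j. - 1 + u j $ i * (1 / \<kappa> $ i) \<le> real (n j i)) sequentially"
    proof (rule always_eventually, rule allI)
      show "- 1 + u j $ i * (1 / \<kappa> $ i) \<le> real (n j i)" for j
        using n[of j i] by simp
    qed
  qed
  then show "filterlim (\<lambda>j. n j i) at_top sequentially"
    by (simp only: filterlim_sequentially_iff_filterlim_real)
next
  have one: "(\<lambda>j. real (n j i) * \<kappa> $ i / u j $ i) \<longlonglongrightarrow> 1" for i
  proof (rule LIM_zero_cancel, rule Lim_null_comparison)
    show "eventually (\<lambda>j. norm (real (n j i) * \<kappa> $ i / u j $ i - 1) \<le> \<kappa> $ i / u j $ i) sequentially"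
    proof (rule always_eventually, rule allI)
      fix j
      have "real (n j i) * \<kappa> $ i / u j $ i - 1 = (real (n j i) - u j $ i / \<kappa> $ i) * (\<kappa> $ i / u j $ i)"
        using \<kappa>[of i] u[of j i] by (simp add: field_simps)
      then have "norm (real (n j i) * \<kappa> $ i / u j $ i - 1)
          = \<bar>real (n j i) - u j $ i / \<kappa> $ i\<bar> * (\<kappa> $ i / u j $ i)"
        using \<kappa>[of i] u[of j i] by (simp add: abs_mult)
      also have "\<dots> \<le> 1 * (\<kappa> $ i / u j $ i)"
        using \<kappa>[of i] u[of j i] by (intro mult_right_mono n) simp
      finally show "norm (real (n j i) * \<kappa> $ i / u j $ i - 1) \<le> \<kappa> $ i / u j $ i" by simp
    qed
    show "(\<lambda>j. \<kappa> $ i / u j $ i) \<longlonglongrightarrow> 0"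
      by (rule real_tendsto_divide_at_top[OF tendsto_const u_lim])
  qed
  have "(\<Prod>i\<in>UNIV. real (n j i)) * vol (corner_cube \<kappa>) / vol (corner_cube (u j))
      = (\<Prod>i\<in>UNIV. real (n j i) * \<kappa> $ i / u j $ i)" for j
    using \<kappa> u by (simp add: vol_corner_cube prod.distrib prod_dividef)
  moreover have "(\<lambda>j. \<Prod>i\<in>UNIV. real (n j i) * \<kappa> $ i / u j $ i) \<longlonglongrightarrow> (\<Prod>i\<in>(UNIV :: 'n set). 1)"
    by (intro tendsto_prod one)
  ultimately show "(\<lambda>j. (\<Prod>i\<in>UNIV. real (n j i)) * vol (corner_cube \<kappa>) / vol (corner_cube (u j))) \<longlonglongrightarrow> 1"
    by simp
qed

text \<open>Here \<open>V\<close> is the volume of the box, \<open>v\<close> that of a tile,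
  \<open>P\<close> the number of tiles and \<open>S\<close> their sum. The right sides isolate
  \<open>P * v / V\<close>, the ratio that tends to 1 in the applications.\<close>

lemma tile_average_identities:
  fixes V v P S c :: real
  assumes "0 < V" "0 < v" "0 < P"
  shows "(S + c * (V - P * v)) / V = S / P * (P * v / V / v) + c * (1 - P * v / V)"
    and "(S - t * P - c * (P * v - V)) / V = (S / P - t) * (P * v / V / v) - c * (P * v / V - 1)"
proof -
  have "S / P * (P * v / V / v) = S / V" "t * (P * v / V / v) = t * P / V"
    using assms by simp_all
  moreover have "c * (1 - P * v / V) = c * (V - P * v) / V" "c * (P * v / V - 1) = c * (P * v - V) / V"
    using assms by (simp_all add: diff_divide_distrib right_diff_distrib)
  ultimately show "(S + c * (V - P * v)) / V = S / P * (P * v / V / v) + c * (1 - P * v / V)"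
    "(S - t * P - c * (P * v - V)) / V = (S / P - t) * (P * v / V / v) - c * (P * v / V - 1)"
    by (simp_all only: add_divide_distrib diff_divide_distrib left_diff_distrib)
qed

context subadditive_cube_process
begin

text \<open>The empty box is not in \<open>cubes\<close>, so nothing is known about \<open>R\<close>
  there; the value 0 makes cuts with an empty part valid in the lattice setting, where sides may be
  0.\<close>

definition grid_R :: "real ^ 'n \<Rightarrow> ('n \<Rightarrow> nat) \<Rightarrow> 'a \<Rightarrow> real" where
  "grid_R \<kappa> n \<omega> = (if \<exists>i. n i = 0 then 0 else R (corner_cube (grid_pt \<kappa> n)) \<omega>)"

lemma grid_R_degenerate: "n i = 0 \<Longrightarrow> grid_R \<kappa> n \<omega> = 0"
  unfolding grid_R_def by (rule if_P) blast

lemma grid_R_nondegenerate: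
  assumes "\<And>i. 0 < n i"
  shows "grid_R \<kappa> n = R (corner_cube (grid_pt \<kappa> n))"
proof -
  have "n i \<noteq> 0" for i using assms[of i] by simp
  then have "\<not> (\<exists>i. n i = 0)" by blast
  then show ?thesis unfolding grid_R_def by (intro ext if_not_P)
qed

lemma lattice_action_grid: "lattice_action M (\<lambda>p. \<tau> (grid_pt \<kappa> p))"
  by unfold_locales (simp_all add: tau_distr grid_pt_zero tau_zero grid_pt_add tau_add)

context
  fixes \<kappa> :: "real ^ 'n"
  assumes \<kappa>: "\<And>i. 0 < \<kappa> $ i"
begin

interpretation L: lattice_action M "\<lambda>p. \<tau> (grid_pt \<kappa> p)"
  by (rule lattice_action_grid)

abbreviation (input) "tile_sum \<equiv> L.box_sum (R (corner_cube \<kappa>))"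
abbreviation (input) "defect \<equiv> (\<integral>\<omega>. R (corner_cube \<kappa>) \<omega> \<partial>M) - \<gamma> * vol (corner_cube \<kappa>)"

lemma grid_cube_in_cubes: "(\<And>i. 0 < n i) \<Longrightarrow> corner_cube (grid_pt \<kappa> n) \<in> cubes"
  using \<kappa> by (intro corner_cube_in_cubes) simp

lemma tile_measurable [measurable]: "R (corner_cube \<kappa>) \<in> borel_measurable M"
  by (intro R_measurable corner_cube_in_cubes \<kappa>)

lemma grid_R_nonneg:
  assumes "\<omega> \<in> space M"
  shows "0 \<le> grid_R \<kappa> n \<omega>"
proof (cases "\<exists>i. n i = 0")
  case True
  then obtain i where "n i = 0" by blast
  then show ?thesis by (simp only: grid_R_degenerate order.refl)
next
  case False
  then have n: "0 < n i" for i by simp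
  show ?thesis
    unfolding grid_R_nondegenerate[OF n] using R_bound[OF assms grid_cube_in_cubes[OF n]] by simp
qed

lemma grid_R_integrable: "integrable M (grid_R \<kappa> n)"
proof (cases "\<exists>i. n i = 0")
  case True
  then obtain i where "n i = 0" by blast
  then have "grid_R \<kappa> n = (\<lambda>_. 0)" by (intro ext grid_R_degenerate)
  then show ?thesis by simp
next
  case False
  then have n: "0 < n i" for i by simp
  show ?thesis unfolding grid_R_nondegenerate[OF n] by (rule R_integrable[OF grid_cube_in_cubes[OF n]])
qed

text \<open>The far piece of the cut is a translate of a lattice box at the origin, and stationarity
  transfers the translation from the box to \<open>\<omega>\<close>.\<close>

lemma grid_R_subadditive:
  assumes \<omega>: "\<omega> \<in> space M" and ab: "n i = a + b"
  shows "grid_R \<kappa> n \<omega>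
    \<le> grid_R \<kappa> (n(i := a)) \<omega> + grid_R \<kappa> (n(i := b)) (\<tau> (grid_pt \<kappa> (axis_pt i a)) \<omega>)"
proof (cases "(\<exists>j. n j = 0) \<or> a = 0 \<or> b = 0")
  case True
  then consider "\<exists>j. n j = 0" | "a = 0" | "b = 0" by blast
  then show ?thesis
  proof cases
    case 1
    then have "grid_R \<kappa> n \<omega> = 0" using grid_R_degenerate by blast
    then show ?thesis using grid_R_nonneg tau_space \<omega> by simp
  next
    case 2
    then have "n(i := b) = n" using ab by auto
    moreover have "\<tau> (grid_pt \<kappa> (axis_pt i a)) \<omega> = \<omega>"
      using L.T_axis_zero[OF \<omega>] 2 by simp
    ultimately show ?thesis using grid_R_nonneg[OF \<omega>] by simp
  next
    case 3
    then have "n(i := a) = n" using ab by auto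
    then show ?thesis using grid_R_nonneg tau_space \<omega> by simp
  qed
next
  case False
  let ?s = "grid_pt \<kappa> (axis_pt i a)"
  have n: "0 < n j" for j using False by simp
  have pos: "0 < a" "0 < b" using False by simp_all
  have "R (half_open_box 0 (grid_pt \<kappa> n)) \<omega>
      \<le> R (half_open_box 0 (vec_upd (grid_pt \<kappa> n) i (real a * \<kappa> $ i))) \<omega>
        + R (half_open_box (vec_upd 0 i (real a * \<kappa> $ i)) (grid_pt \<kappa> n)) \<omega>"
    using \<kappa> n pos ab by (intro R_cut \<omega>) simp_all
  also have "vec_upd (grid_pt \<kappa> n) i (real a * \<kappa> $ i) = grid_pt \<kappa> (n(i := a))"
    by (simp add: vec_eq_iff)
  also have "vec_upd 0 i (real a * \<kappa> $ i) = ?s + 0"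
    by (simp add: vec_eq_iff axis_pt_def)
  also have "grid_pt \<kappa> n = ?s + grid_pt \<kappa> (n(i := b))"
    using ab by (simp add: vec_eq_iff axis_pt_def algebra_simps)
  also have "R (half_open_box (?s + 0) (?s + grid_pt \<kappa> (n(i := b)))) \<omega>
      = R (half_open_box 0 (grid_pt \<kappa> (n(i := b)))) (\<tau> ?s \<omega>)"
    using \<kappa> n pos by (intro R_translate \<omega>) simp
  finally have "R (half_open_box 0 (?s + grid_pt \<kappa> (n(i := b)))) \<omega>
     \<le> R (half_open_box 0 (grid_pt \<kappa> (n(i := a)))) \<omega>
       + R (half_open_box 0 (grid_pt \<kappa> (n(i := b)))) (\<tau> ?s \<omega>)" .
  moreover have "?s + grid_pt \<kappa> (n(i := b)) = grid_pt \<kappa> n"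
    using ab by (simp add: vec_eq_iff axis_pt_def algebra_simps)
  moreover have "grid_R \<kappa> n = R (corner_cube (grid_pt \<kappa> n))"
    by (rule grid_R_nondegenerate[OF n])
  moreover have "grid_R \<kappa> (n(i := a)) = R (corner_cube (grid_pt \<kappa> (n(i := a))))"
    "grid_R \<kappa> (n(i := b)) = R (corner_cube (grid_pt \<kappa> (n(i := b))))"
    using n pos by (intro grid_R_nondegenerate; simp)+
  ultimately show ?thesis
    unfolding corner_cube_def by simp
qed

lemma grid_R_le_tile_sum:
  assumes \<omega>: "\<omega> \<in> space M"
  shows "grid_R \<kappa> n \<omega> \<le> tile_sum n \<omega>"
proof -
  have "(\<Sum>y\<in>lbox n. - grid_R \<kappa> (\<lambda>_. 1) (\<tau> (grid_pt \<kappa> (\<lambda>i. y i * 1)) \<omega>)) \<le> - grid_R \<kappa> (\<lambda>i. n i * 1) \<omega>"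
  proof (rule L.grid_superadditive[where F = "\<lambda>n \<omega>. - grid_R \<kappa> n \<omega>"])
    show "- grid_R \<kappa> (n(i := a)) \<omega> + - grid_R \<kappa> (n(i := b)) (\<tau> (grid_pt \<kappa> (axis_pt i a)) \<omega>)
        \<le> - grid_R \<kappa> n \<omega>" if "\<omega> \<in> space M" "n i = a + b" for n i a b \<omega>
      using grid_R_subadditive[of \<omega> n i a b] that by simp
    show "0 \<le> - grid_R \<kappa> n \<omega>" if "n i = 0" for n i \<omega>
      using grid_R_degenerate[of n i \<kappa> \<omega>, OF that] by simp
  qed (rule \<omega>)
  moreover have "grid_R \<kappa> (\<lambda>_. 1) = R (corner_cube \<kappa>)"
  proof -
    have "grid_pt \<kappa> (\<lambda>_. 1) = \<kappa>" by (simp add: vec_eq_iff)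
    then show ?thesis using grid_R_nondegenerate[of "\<lambda>_. 1" \<kappa>] by simp
  qed
  ultimately show ?thesis
    by (simp add: L.box_sum_def sum_negf)
qed

lemma tile_integrable: "integrable M (\<lambda>\<omega>. R (corner_cube \<kappa>) (\<tau> s \<omega>))"
proof (rule integrable_const_bound[where B = "C * vol (corner_cube \<kappa>)"])
  show "AE \<omega> in M. norm (R (corner_cube \<kappa>) (\<tau> s \<omega>)) \<le> C * vol (corner_cube \<kappa>)"
    using R_bound[OF tau_space corner_cube_in_cubes[of \<kappa>, OF \<kappa>]] by (intro AE_I2) simp
qed measurable

lemma tile_sum_integrable: "integrable M (tile_sum n)"
  unfolding L.box_sum_def by (intro Bochner_Integration.integrable_sum tile_integrable)

lemma integral_tile_sum:
  "(\<integral>\<omega>. tile_sum n \<omega> \<partial>M) = (\<Prod>i\<in>UNIV. real (n i)) * (\<integral>\<omega>. R (corner_cube \<kappa>) \<omega> \<partial>M)"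
  unfolding L.box_sum_def
  by (simp add: Bochner_Integration.integral_sum[OF tile_integrable] integral_tau card_lbox)

lemma integral_grid_R_ge:
  "\<gamma> * vol (corner_cube \<kappa>) * (\<Prod>i\<in>UNIV. real (n i)) \<le> (\<integral>\<omega>. grid_R \<kappa> n \<omega> \<partial>M)"
proof (cases "\<exists>i. n i = 0")
  case True
  then obtain i where i: "n i = 0" by blast
  have "(\<Prod>i\<in>UNIV. real (n i)) = 0"
    using i by (intro prod_zero) auto
  moreover have "grid_R \<kappa> n = (\<lambda>_. 0)" using grid_R_degenerate[of n i, OF i] by (simp add: fun_eq_iff)
  ultimately show ?thesis by (simp only: mult_zero_right) simp
next
  case False
  then have n: "0 < n i" for i by simp
  have "\<gamma> * vol (corner_cube (grid_pt \<kappa> n)) \<le> (\<integral>\<omega>. R (corner_cube (grid_pt \<kappa> n)) \<omega> \<partial>M)"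
    using \<kappa> n by (intro spatial_constant_le) simp
  then show ?thesis
    unfolding grid_R_nondegenerate[OF n] by (simp add: vol_grid_cube \<kappa> n mult_ac)
qed

text \<open>Tile sums are additive under cuts, so the difference inherits superadditivity. Their
  mean is the number of tiles times that of one tile, while \<open>R\<close> has mean at least
  \<open>\<gamma>\<close> times the volume on every box; hence the single number
  \<open>defect\<close> serves for all boxes.\<close>

lemma superadditive_defect:
  "superadditive_lattice_process M (\<lambda>p. \<tau> (grid_pt \<kappa> p)) (\<lambda>n \<omega>. tile_sum n \<omega> - grid_R \<kappa> n \<omega>) defect"
proof unfold_locales
  show "integrable M (\<lambda>\<omega>. tile_sum n \<omega> - grid_R \<kappa> n \<omega>)" for n
    by (intro Bochner_Integration.integrable_diff tile_sum_integrable grid_R_integrable)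
  show "0 \<le> tile_sum n \<omega> - grid_R \<kappa> n \<omega>" if "\<omega> \<in> space M" for n \<omega>
    using grid_R_le_tile_sum[OF that] by simp
  show "tile_sum (n(i := a)) \<omega> - grid_R \<kappa> (n(i := a)) \<omega>
      + (tile_sum (n(i := b)) (\<tau> (grid_pt \<kappa> (axis_pt i a)) \<omega>)
        - grid_R \<kappa> (n(i := b)) (\<tau> (grid_pt \<kappa> (axis_pt i a)) \<omega>))
      \<le> tile_sum n \<omega> - grid_R \<kappa> n \<omega>" if "\<omega> \<in> space M" "n i = a + b" for n i a b \<omega>
    using grid_R_subadditive[of \<omega> n i a b, OF that]
      L.box_sum_add[of \<omega> n i a b "R (corner_cube \<kappa>)", OF that] by linarith
  show "(\<integral>\<omega>. tile_sum n \<omega> - grid_R \<kappa> n \<omega> \<partial>M) \<le> defect * (\<Prod>i\<in>UNIV. real (n i))" for n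
    using integral_grid_R_ge[of n]
    by (simp add: Bochner_Integration.integral_diff[OF tile_sum_integrable grid_R_integrable]
        integral_tile_sum algebra_simps)
qed

section \<open>Rounding a growing box to lattice boxes\<close>

context
  fixes u :: "nat \<Rightarrow> real ^ 'n"
  assumes u_pos: "\<And>j i. 0 < u j $ i" and u_mono: "\<And>i. mono (\<lambda>j. u j $ i)"
    and u_lim: "\<And>i. filterlim (\<lambda>j. u j $ i) at_top sequentially"
begin

text \<open>Upper bounds use the lattice box inside and lower bounds the one outside, as
  \<open>R_subbox\<close> bounds a box by those it contains. The maximal inequality runs along
  \<open>up\<close>, whose sides are positive and nondecreasing; \<open>dn\<close> may have sides 0
  for small \<open>j\<close>.\<close>

abbreviation (input) "dn \<equiv> \<lambda>j i. nat \<lfloor>u j $ i / \<kappa> $ i\<rfloor>"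
abbreviation (input) "up \<equiv> \<lambda>j i. nat \<lceil>u j $ i / \<kappa> $ i\<rceil>"
abbreviation (input) "ratio n \<equiv> \<lambda>j. (\<Prod>i\<in>UNIV. real (n j i)) * vol (corner_cube \<kappa>) / vol (corner_cube (u j))"

lemma quotient_pos: "0 < u j $ i / \<kappa> $ i"
  using u_pos \<kappa> by simp

lemma dn_close: "\<bar>real (dn j i) - u j $ i / \<kappa> $ i\<bar> \<le> 1"
proof -
  have "real (dn j i) = of_int \<lfloor>u j $ i / \<kappa> $ i\<rfloor>"
    using quotient_pos[of j i] by (subst of_nat_nat) simp_all
  then show ?thesis by linarith
qed

lemma up_close: "\<bar>real (up j i) - u j $ i / \<kappa> $ i\<bar> \<le> 1"
proof -
  have "real (up j i) = of_int \<lceil>u j $ i / \<kappa> $ i\<rceil>"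
    using quotient_pos[of j i] by (subst of_nat_nat) simp_all
  then show ?thesis by linarith
qed

lemma dn_le: "real (dn j i) * \<kappa> $ i \<le> u j $ i"
proof -
  have "real (dn j i) \<le> u j $ i / \<kappa> $ i"
    using quotient_pos[of j i] by (subst of_nat_nat) simp_all
  then show ?thesis using \<kappa>[of i] by (simp add: field_simps)
qed

lemma up_ge: "u j $ i \<le> real (up j i) * \<kappa> $ i"
proof -
  have "u j $ i / \<kappa> $ i \<le> real (up j i)" by (rule real_nat_ceiling_ge)
  then show ?thesis using \<kappa>[of i] by (simp add: field_simps)
qed

lemma up_pos: "0 < up j i"
  using quotient_pos[of j i] by simp

lemma up_mono: "mono (\<lambda>j. up j i)"
proof (rule monoI)
  fix j l :: nat assume "j \<le> l"
  then have "u j $ i / \<kappa> $ i \<le> u l $ i / \<kappa> $ i"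
    using u_mono[of i] \<kappa>[of i] by (intro divide_right_mono) (auto dest: monoD)
  then show "up j i \<le> up l i" by (intro nat_mono ceiling_mono)
qed

lemma vol_pos_u: "0 < vol (corner_cube (u j))"
  by (rule vol_corner_cube_pos) (rule u_pos)

lemma vol_pos_kappa: "0 < vol (corner_cube \<kappa>)"
  by (rule vol_corner_cube_pos) (rule \<kappa>)

lemma R_le_tile_average:
  assumes \<omega>: "\<omega> \<in> space M" and dn: "\<And>i. 0 < dn j i"
  shows "R (corner_cube (u j)) \<omega> / vol (corner_cube (u j))
    \<le> tile_sum (dn j) \<omega> / (\<Prod>i\<in>UNIV. real (dn j i)) * (ratio dn j / vol (corner_cube \<kappa>))
      + C * (1 - ratio dn j)"
proof -
  let ?V = "vol (corner_cube (u j))" and ?v = "vol (corner_cube \<kappa>)" and ?P = "\<Prod>i\<in>UNIV. real (dn j i)"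
  have P: "0 < ?P" using dn by (intro prod_pos) simp
  have "R (corner_cube (u j)) \<omega> \<le> R (corner_cube (grid_pt \<kappa> (dn j))) \<omega>
      + C * (?V - vol (corner_cube (grid_pt \<kappa> (dn j))))"
    using dn \<kappa> dn_le by (intro R_corner_subbox \<omega>) simp_all
  also have "vol (corner_cube (grid_pt \<kappa> (dn j))) = ?P * ?v"
    by (intro vol_grid_cube \<kappa> dn)
  also have "R (corner_cube (grid_pt \<kappa> (dn j))) \<omega> = grid_R \<kappa> (dn j) \<omega>"
    unfolding grid_R_nondegenerate[OF dn] ..
  also have "grid_R \<kappa> (dn j) \<omega> \<le> tile_sum (dn j) \<omega>"
    by (rule grid_R_le_tile_sum[OF \<omega>])
  finally have "R (corner_cube (u j)) \<omega> / ?V \<le> (tile_sum (dn j) \<omega> + C * (?V - ?P * ?v)) / ?V"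
    using vol_pos_u[of j] by (intro divide_right_mono) simp_all
  also have "\<dots> = tile_sum (dn j) \<omega> / ?P * (ratio dn j / ?v) + C * (1 - ratio dn j)"
    by (rule tile_average_identities(1)[OF vol_pos_u vol_pos_kappa P])
  finally show ?thesis .
qed

text \<open>Subadditivity points the wrong way here. The assumption \<open>good\<close>, which holds
  off the event of the maximal inequality, turns the tile sum into a lower bound for
  \<open>R\<close> on the outer lattice box.\<close>

lemma R_ge_tile_average:
  assumes \<omega>: "\<omega> \<in> space M"
    and good: "tile_sum (up j) \<omega> - grid_R \<kappa> (up j) \<omega> \<le> \<theta> * (\<Prod>i\<in>UNIV. real (up j i))"
  shows "(tile_sum (up j) \<omega> / (\<Prod>i\<in>UNIV. real (up j i)) - \<theta>) * (ratio up j / vol (corner_cube \<kappa>))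
      - C * (ratio up j - 1)
    \<le> R (corner_cube (u j)) \<omega> / vol (corner_cube (u j))"
proof -
  let ?V = "vol (corner_cube (u j))" and ?v = "vol (corner_cube \<kappa>)" and ?P = "\<Prod>i\<in>UNIV. real (up j i)"
  have P: "0 < ?P" by (intro prod_pos ballI of_nat_0_less_iff[THEN iffD2] up_pos)
  have "R (corner_cube (grid_pt \<kappa> (up j))) \<omega> \<le> R (corner_cube (u j)) \<omega>
      + C * (vol (corner_cube (grid_pt \<kappa> (up j))) - ?V)"
    using u_pos up_ge by (intro R_corner_subbox \<omega>) simp_all
  also have "vol (corner_cube (grid_pt \<kappa> (up j))) = ?P * ?v"
    by (intro vol_grid_cube \<kappa> up_pos)
  also have "R (corner_cube (grid_pt \<kappa> (up j))) \<omega> = grid_R \<kappa> (up j) \<omega>"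
    unfolding grid_R_nondegenerate[OF up_pos] ..
  finally have "tile_sum (up j) \<omega> - \<theta> * ?P - C * (?P * ?v - ?V) \<le> R (corner_cube (u j)) \<omega>"
    using good by linarith
  then have "(tile_sum (up j) \<omega> - \<theta> * ?P - C * (?P * ?v - ?V)) / ?V \<le> R (corner_cube (u j)) \<omega> / ?V"
    using vol_pos_u[of j] by (intro divide_right_mono) simp_all
  also have "(tile_sum (up j) \<omega> - \<theta> * ?P - C * (?P * ?v - ?V)) / ?V
      = (tile_sum (up j) \<omega> / ?P - \<theta>) * (ratio up j / ?v) - C * (ratio up j - 1)"
    by (rule tile_average_identities(2)[OF vol_pos_u vol_pos_kappa P])
  finally show ?thesis .
qed

lemma eventually_dn_pos: "eventually (\<lambda>j. \<forall>i. 0 < dn j i) sequentially"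
proof (rule eventually_all_finite)
  fix i
  have "filterlim (\<lambda>j. dn j i) at_top sequentially"
    by (rule grid_approximation(1)[OF \<kappa> u_pos u_lim dn_close])
  then show "eventually (\<lambda>j. 0 < dn j i) sequentially"
    by (rule eventually_compose_filterlim[OF eventually_gt_at_top[of 0]])
qed

text \<open>Off the exceptional event the quotients are eventually between
  \<open>f / v - 2 * \<delta>\<close> and \<open>f / v + \<delta>\<close>, where \<open>f\<close> is
  the common limit of the inner and outer tile averages and \<open>v\<close> the tile volume. Below,
  one \<open>\<delta>\<close> is the defect and one the passage to the limit; the window has length
  \<open>3 * \<delta>\<close>. The event does not mention the tile, which can therefore be optimised
  afterwards.\<close>

lemma prob_oscillation_le:
  assumes \<delta>: "0 < \<delta>"
  shows "prob {\<omega>\<in>space M. \<not> (\<exists>N. \<forall>i\<ge>N. \<forall>j\<ge>N.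
      \<bar>R (corner_cube (u i)) \<omega> / vol (corner_cube (u i)) - R (corner_cube (u j)) \<omega> / vol (corner_cube (u j))\<bar> \<le> 3 * \<delta>)}
    \<le> 8 ^ CARD('n) * defect / (\<delta> * vol (corner_cube \<kappa>))"
proof -
  interpret F: superadditive_lattice_process M "\<lambda>p. \<tau> (grid_pt \<kappa> p)"
    "\<lambda>n \<omega>. tile_sum n \<omega> - grid_R \<kappa> n \<omega>" defect
    by (rule superadditive_defect)
  let ?v = "vol (corner_cube \<kappa>)"
  let ?x = "\<lambda>j \<omega>. R (corner_cube (u j)) \<omega> / vol (corner_cube (u j))"
  \<comment> \<open>A defect of \<open>\<theta>\<close> per tile is a defect of
    \<open>\<delta>\<close> per unit volume.\<close>
  define \<theta> where "\<theta> = \<delta> * ?v"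
  have \<theta>: "0 < \<theta>" unfolding \<theta>_def using \<delta> vol_pos_kappa by simp
  define bad where "bad = {\<omega>\<in>space M. \<exists>j. \<theta> * (\<Prod>i\<in>UNIV. real (up j i)) < tile_sum (up j) \<omega> - grid_R \<kappa> (up j) \<omega>}"
  have [measurable]: "grid_R \<kappa> n \<in> borel_measurable M" for n
    using grid_R_integrable by auto
  have bad_meas: "bad \<in> sets M"
    unfolding bad_def by measurable
  have bad_le: "prob bad \<le> 8 ^ CARD('n) * defect / \<theta>"
    unfolding bad_def by (rule F.maximal_inequality[OF up_pos up_mono \<theta>])
  have tile_bound: "\<bar>R (corner_cube \<kappa>) \<omega>\<bar> \<le> C * ?v" if "\<omega> \<in> space M" for \<omega>
    using R_bound[OF that corner_cube_in_cubes[of \<kappa>, OF \<kappa>]] by simp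
  obtain f where f: "\<And>n. (\<And>i. filterlim (\<lambda>j. n j i) at_top sequentially) \<Longrightarrow>
      AE \<omega> in M. (\<lambda>j. tile_sum (n j) \<omega> / (\<Prod>i\<in>UNIV. real (n j i))) \<longlonglongrightarrow> f \<omega>"
    using L.box_average_convergence[OF tile_measurable tile_bound] by blast
  have "AE \<omega> in M. \<omega> \<in> {\<omega>\<in>space M. \<not> (\<exists>N. \<forall>i\<ge>N. \<forall>j\<ge>N. \<bar>?x i \<omega> - ?x j \<omega>\<bar> \<le> 3 * \<delta>)} \<longrightarrow> \<omega> \<in> bad"
    using f[of dn, OF grid_approximation(1)[OF \<kappa> u_pos u_lim dn_close]]
      f[of up, OF grid_approximation(1)[OF \<kappa> u_pos u_lim up_close]] AE_space
  proof eventually_elim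
    case (elim \<omega>)
    note \<omega> = elim(3)
    show ?case
    proof (rule impI, rule ccontr)
      assume osc: "\<omega> \<in> {\<omega>\<in>space M. \<not> (\<exists>N. \<forall>i\<ge>N. \<forall>j\<ge>N. \<bar>?x i \<omega> - ?x j \<omega>\<bar> \<le> 3 * \<delta>)}"
        and "\<omega> \<notin> bad"
      then have good: "tile_sum (up j) \<omega> - grid_R \<kappa> (up j) \<omega> \<le> \<theta> * (\<Prod>i\<in>UNIV. real (up j i))" for j
        using \<omega> unfolding bad_def by (simp add: not_less)
      have "(\<lambda>j. tile_sum (dn j) \<omega> / (\<Prod>i\<in>UNIV. real (dn j i)) * (ratio dn j / ?v) + C * (1 - ratio dn j))
          \<longlonglongrightarrow> f \<omega> * (1 / ?v) + C * (1 - 1)"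
        (is "?X \<longlonglongrightarrow> _")
        using vol_pos_kappa
        by (intro tendsto_add tendsto_mult elim(1) tendsto_divide tendsto_const tendsto_diff
            grid_approximation(2)[OF \<kappa> u_pos u_lim dn_close]) simp
      then have "?X \<longlonglongrightarrow> f \<omega> / ?v" by (simp only: diff_self mult_zero_right add_0_right times_divide_eq_right mult_1_right)
      then have "eventually (\<lambda>j. tile_sum (dn j) \<omega> / (\<Prod>i\<in>UNIV. real (dn j i)) * (ratio dn j / ?v)
          + C * (1 - ratio dn j) < f \<omega> / ?v + \<delta>) sequentially"
        by (rule order_tendstoD(2)) (use \<delta> in linarith)
      then have upper: "eventually (\<lambda>j. ?x j \<omega> < f \<omega> / ?v + \<delta>) sequentially"
        using eventually_dn_pos
      proof eventually_elim
        case (elim j)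
        show ?case
          by (rule le_less_trans[OF R_le_tile_average[OF \<omega>] elim(1)]) (rule elim(2)[rule_format])
      qed
      have "(\<lambda>j. (tile_sum (up j) \<omega> / (\<Prod>i\<in>UNIV. real (up j i)) - \<theta>) * (ratio up j / ?v) - C * (ratio up j - 1))
          \<longlonglongrightarrow> (f \<omega> - \<theta>) * (1 / ?v) - C * (1 - 1)"
        (is "?Y \<longlonglongrightarrow> _")
        using vol_pos_kappa
        by (intro tendsto_mult elim(2) tendsto_divide tendsto_const tendsto_diff
            grid_approximation(2)[OF \<kappa> u_pos u_lim up_close]) simp
      moreover have "(f \<omega> - \<theta>) * (1 / ?v) - C * (1 - 1) = f \<omega> / ?v - \<delta>"
        using vol_pos_kappa by (simp add: \<theta>_def diff_divide_distrib)
      ultimately have "?Y \<longlonglongrightarrow> f \<omega> / ?v - \<delta>" by (simp only:)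
      then have "eventually (\<lambda>j. f \<omega> / ?v - 2 * \<delta> <
          (tile_sum (up j) \<omega> / (\<Prod>i\<in>UNIV. real (up j i)) - \<theta>) * (ratio up j / ?v) - C * (ratio up j - 1))
          sequentially"
        by (rule order_tendstoD(1)) (use \<delta> in linarith)
      then have "eventually (\<lambda>j. f \<omega> / ?v - 2 * \<delta> < ?x j \<omega>) sequentially"
      proof eventually_elim
        case (elim j)
        show ?case
          by (rule less_le_trans[OF elim R_ge_tile_average[OF \<omega> good]])
      qed
      with upper have "eventually (\<lambda>j. f \<omega> / ?v - 2 * \<delta> < ?x j \<omega> \<and> ?x j \<omega> < f \<omega> / ?v + \<delta>) sequentially"
        by (rule eventually_conj[rotated])
      then obtain N where N: "\<And>j. N \<le> j \<Longrightarrow> f \<omega> / ?v - 2 * \<delta> < ?x j \<omega> \<and> ?x j \<omega> < f \<omega> / ?v + \<delta>"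
        unfolding eventually_sequentially by blast
      have "\<bar>?x i \<omega> - ?x j \<omega>\<bar> \<le> 3 * \<delta>" if "N \<le> i" "N \<le> j" for i j
        using N[OF that(1)] N[OF that(2)] by linarith
      then show False using osc by blast
    qed
  qed
  then have "prob {\<omega>\<in>space M. \<not> (\<exists>N. \<forall>i\<ge>N. \<forall>j\<ge>N. \<bar>?x i \<omega> - ?x j \<omega>\<bar> \<le> 3 * \<delta>)} \<le> prob bad"
    by (rule finite_measure_mono_AE[OF _ bad_meas])
  also note bad_le
  finally show ?thesis unfolding \<theta>_def .
qed

text \<open>Integrating the upper estimate removes the tile sum, whose mean is the number of tiles
  times the mean of one tile.\<close>

lemma limit_mean_le:
  assumes lim: "(\<lambda>j. (\<integral>\<omega>. R (corner_cube (u j)) \<omega> \<partial>M) / vol (corner_cube (u j))) \<longlonglongrightarrow> m"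
  shows "m \<le> (\<integral>\<omega>. R (corner_cube \<kappa>) \<omega> \<partial>M) / vol (corner_cube \<kappa>)"
proof -
  let ?v = "vol (corner_cube \<kappa>)" and ?E = "\<integral>\<omega>. R (corner_cube \<kappa>) \<omega> \<partial>M"
  have "(\<lambda>j. ?E * (ratio dn j / ?v) + C * (1 - ratio dn j)) \<longlonglongrightarrow> ?E * (1 / ?v) + C * (1 - 1)"
    using vol_pos_kappa
    by (intro tendsto_add tendsto_mult tendsto_divide tendsto_const tendsto_diff
        grid_approximation(2)[OF \<kappa> u_pos u_lim dn_close]) simp
  moreover have "eventually (\<lambda>j. (\<integral>\<omega>. R (corner_cube (u j)) \<omega> \<partial>M) / vol (corner_cube (u j))
      \<le> ?E * (ratio dn j / ?v) + C * (1 - ratio dn j)) sequentially"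
    using eventually_dn_pos
  proof eventually_elim
    case (elim j)
    let ?P = "\<Prod>i\<in>UNIV. real (dn j i)"
    have P: "0 < ?P" using elim by (intro prod_pos) simp
    have int: "integrable M (\<lambda>\<omega>. tile_sum (dn j) \<omega> / ?P * (ratio dn j / ?v) + C * (1 - ratio dn j))"
      by (intro Bochner_Integration.integrable_add integrable_mult_left integrable_divide
          tile_sum_integrable) simp
    have "(\<integral>\<omega>. R (corner_cube (u j)) \<omega> \<partial>M) / vol (corner_cube (u j))
        = (\<integral>\<omega>. R (corner_cube (u j)) \<omega> / vol (corner_cube (u j)) \<partial>M)" by simp
    also have "\<dots> \<le> (\<integral>\<omega>. tile_sum (dn j) \<omega> / ?P * (ratio dn j / ?v) + C * (1 - ratio dn j) \<partial>M)"
      using elim u_pos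
      by (intro integral_mono int R_le_tile_average integrable_divide R_integrable corner_cube_in_cubes) auto
    also have "\<dots> = (\<integral>\<omega>. tile_sum (dn j) \<omega> \<partial>M) / ?P * (ratio dn j / ?v) + C * (1 - ratio dn j)"
      by (subst Bochner_Integration.integral_add)
        (simp_all add: tile_sum_integrable prob_space)
    also have "\<dots> = ?E * (ratio dn j / ?v) + C * (1 - ratio dn j)"
      unfolding integral_tile_sum using P by simp
    finally show ?case .
  qed
  ultimately have "m \<le> ?E * (1 / ?v) + C * (1 - 1)"
    by (intro tendsto_le[OF sequentially_bot _ lim])
  then show ?thesis by simp
qed

end

end

end

section \<open>Convergence and the ergodic case\<close>

context subadditive_cube_process
begin

text \<open>The tile is chosen after \<open>\<delta>\<close> and \<open>e\<close>, so each
  oscillation event is null and the quotients are almost surely Cauchy. The mean of the limit is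
  squeezed between the infimum \<open>\<gamma>\<close> and the mean per volume of an arbitrary
  tile.\<close>

theorem corner_cube_limit:
  fixes u :: "nat \<Rightarrow> real ^ 'n"
  assumes u_pos: "\<And>j i. 0 < u j $ i" and u_mono: "\<And>i. mono (\<lambda>j. u j $ i)"
    and u_lim: "\<And>i. filterlim (\<lambda>j. u j $ i) at_top sequentially"
  obtains f where "integrable M f"
    "AE \<omega> in M. (\<lambda>j. R (corner_cube (u j)) \<omega> / vol (corner_cube (u j))) \<longlonglongrightarrow> f \<omega>"
    "(\<lambda>j. (\<integral>\<omega>. R (corner_cube (u j)) \<omega> \<partial>M) / vol (corner_cube (u j))) \<longlonglongrightarrow> \<gamma>"
    "(\<integral>\<omega>. f \<omega> \<partial>M) = \<gamma>"
proof -
  define x where "x j \<omega> = R (corner_cube (u j)) \<omega> / vol (corner_cube (u j))" for j \<omega>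
  have cube: "corner_cube (u j) \<in> cubes" for j
    by (intro corner_cube_in_cubes u_pos)
  have V: "0 < vol (corner_cube (u j))" for j
    by (intro vol_corner_cube_pos u_pos)
  have [measurable]: "R (corner_cube (u j)) \<in> borel_measurable M" for j
    by (rule R_measurable[OF cube])
  have x_meas [measurable]: "x j \<in> borel_measurable M" for j
    unfolding x_def by measurable
  have x_ge: "0 \<le> x j \<omega>" and x_le: "x j \<omega> \<le> C" if "\<omega> \<in> space M" for j \<omega>
    using R_bound[OF that cube[of j]] V[of j] unfolding x_def by (simp_all add: pos_divide_le_eq)
  define osc where "osc \<delta> = {\<omega>\<in>space M. \<not> (\<exists>N. \<forall>i\<ge>N. \<forall>j\<ge>N. \<bar>x i \<omega> - x j \<omega>\<bar> \<le> 3 * \<delta>)}" for \<delta>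
  have osc_meas: "osc \<delta> \<in> sets M" for \<delta>
    unfolding osc_def by measurable
  have osc_null: "prob (osc \<delta>) = 0" if \<delta>: "0 < \<delta>" for \<delta>
  proof -
    have "prob (osc \<delta>) \<le> 0 + e" if e: "0 < e" for e
    proof -
      \<comment> \<open>Solves \<open>8 ^ d * \<eta> / \<delta> = e\<close> in dimension
        \<open>d\<close>, the left side being the bound for the oscillation event.\<close>
      define \<eta> where "\<eta> = e * \<delta> / 8 ^ CARD('n)"
      have "0 < \<eta>" unfolding \<eta>_def using e \<delta> by simp
      then have "\<gamma> < \<gamma> + \<eta>" by simp
      then obtain \<kappa> :: "real ^ 'n" where \<kappa>: "\<And>i. 0 < \<kappa> $ i"
        and mean: "(\<integral>\<omega>. R (corner_cube \<kappa>) \<omega> \<partial>M) < (\<gamma> + \<eta>) * vol (corner_cube \<kappa>)"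
        using spatial_constant_approx by blast
      have v: "0 < vol (corner_cube \<kappa>)" by (intro vol_corner_cube_pos \<kappa>)
      have "prob (osc \<delta>) \<le> 8 ^ CARD('n) * ((\<integral>\<omega>. R (corner_cube \<kappa>) \<omega> \<partial>M) - \<gamma> * vol (corner_cube \<kappa>))
          / (\<delta> * vol (corner_cube \<kappa>))"
        unfolding osc_def x_def by (rule prob_oscillation_le[OF \<kappa> u_pos u_mono u_lim \<delta>])
      also have "\<dots> \<le> 8 ^ CARD('n) * (\<eta> * vol (corner_cube \<kappa>)) / (\<delta> * vol (corner_cube \<kappa>))"
        using mean v \<delta> by (intro divide_right_mono mult_left_mono) (simp_all add: distrib_right)
      also have "\<dots> = e"
        using v \<delta> unfolding \<eta>_def by simp
      finally show ?thesis by simp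
    qed
    then have "prob (osc \<delta>) \<le> 0" by (rule field_le_epsilon)
    then show ?thesis using measure_nonneg[of M "osc \<delta>"] by linarith
  qed
  have AE_osc: "AE \<omega> in M. \<forall>k. \<omega> \<notin> osc (1 / real (Suc k))"
    unfolding AE_all_countable
  proof
    show "AE \<omega> in M. \<omega> \<notin> osc (1 / real (Suc k))" for k
      using osc_null[of "1 / real (Suc k)"] osc_meas
      by (intro AE_not_in) (simp add: null_sets_def emeasure_eq_measure)
  qed
  have conv: "AE \<omega> in M. convergent (\<lambda>j. x j \<omega>)"
    using AE_osc AE_space
  proof eventually_elim
    case (elim \<omega>)
    have "Cauchy (\<lambda>j. x j \<omega>)"
    proof (rule metric_CauchyI)
      fix e :: real assume "0 < e"
      then obtain k where k: "inverse (real (Suc k)) < e / 4"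
        using reals_Archimedean[of "e / 4"] by auto
      obtain N where N: "\<And>i j. N \<le> i \<Longrightarrow> N \<le> j \<Longrightarrow> \<bar>x i \<omega> - x j \<omega>\<bar> \<le> 3 * (1 / real (Suc k))"
        using elim(1)[rule_format, of k] elim(2) unfolding osc_def by blast
      have "dist (x i \<omega>) (x j \<omega>) < e" if "N \<le> i" "N \<le> j" for i j
        using N[OF that] k \<open>0 < e\<close> unfolding dist_real_def inverse_eq_divide by linarith
      then show "\<exists>N. \<forall>i\<ge>N. \<forall>j\<ge>N. dist (x i \<omega>) (x j \<omega>) < e" by blast
    qed
    then show ?case by (rule Cauchy_convergent)
  qed
  define f where "f \<omega> = max 0 (min C (lim (\<lambda>j. x j \<omega>)))" for \<omega>
  have f_meas [measurable]: "f \<in> borel_measurable M"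
    unfolding f_def by measurable
  have f_le: "\<bar>f \<omega>\<bar> \<le> C" for \<omega>
    using C_nonneg unfolding f_def by auto
  have f_int: "integrable M f"
    using f_le by (intro integrable_const_bound[where B = C]) auto
  have AE_f: "AE \<omega> in M. (\<lambda>j. x j \<omega>) \<longlonglongrightarrow> f \<omega>"
    using conv AE_space
  proof eventually_elim
    case (elim \<omega>)
    then have l: "(\<lambda>j. x j \<omega>) \<longlonglongrightarrow> lim (\<lambda>j. x j \<omega>)"
      by (simp add: convergent_LIMSEQ_iff)
    have "lim (\<lambda>j. x j \<omega>) \<le> C" "0 \<le> lim (\<lambda>j. x j \<omega>)"
      using LIMSEQ_le_const2[OF l, of C] LIMSEQ_le_const[OF l, of 0] x_le x_ge elim(2) by auto
    then show ?case using l unfolding f_def by simp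
  qed
  have "(\<lambda>j. \<integral>\<omega>. x j \<omega> \<partial>M) \<longlonglongrightarrow> (\<integral>\<omega>. f \<omega> \<partial>M)"
    using AE_f x_le x_ge by (intro integral_dominated_convergence[where w = "\<lambda>_. C"]) auto
  then have mean: "(\<lambda>j. (\<integral>\<omega>. R (corner_cube (u j)) \<omega> \<partial>M) / vol (corner_cube (u j))) \<longlonglongrightarrow> (\<integral>\<omega>. f \<omega> \<partial>M)"
    unfolding x_def by simp
  have "\<gamma> \<le> (\<integral>\<omega>. f \<omega> \<partial>M)"
  proof (rule LIMSEQ_le_const[OF mean], intro exI allI impI)
    show "\<gamma> \<le> (\<integral>\<omega>. R (corner_cube (u j)) \<omega> \<partial>M) / vol (corner_cube (u j))" for j
      using spatial_constant_le[of "u j", OF u_pos] V[of j] by (simp add: pos_le_divide_eq)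
  qed
  moreover have "(\<integral>\<omega>. f \<omega> \<partial>M) \<le> \<gamma>"
  proof (rule field_le_epsilon)
    fix e :: real assume "0 < e"
    then have "\<gamma> < \<gamma> + e" by simp
    then obtain \<kappa> :: "real ^ 'n" where \<kappa>: "\<And>i. 0 < \<kappa> $ i"
      and \<kappa>_mean: "(\<integral>\<omega>. R (corner_cube \<kappa>) \<omega> \<partial>M) < (\<gamma> + e) * vol (corner_cube \<kappa>)"
      using spatial_constant_approx by blast
    have "(\<integral>\<omega>. f \<omega> \<partial>M) \<le> (\<integral>\<omega>. R (corner_cube \<kappa>) \<omega> \<partial>M) / vol (corner_cube \<kappa>)"
      by (rule limit_mean_le[OF \<kappa> u_pos u_mono u_lim mean])
    also have "\<dots> \<le> \<gamma> + e"
      using \<kappa>_mean vol_corner_cube_pos[of \<kappa>, OF \<kappa>] by (simp add: pos_divide_le_eq)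
    finally show "(\<integral>\<omega>. f \<omega> \<partial>M) \<le> \<gamma> + e" .
  qed
  ultimately have "(\<integral>\<omega>. f \<omega> \<partial>M) = \<gamma>" by simp
  then show ?thesis
    using that[of f] f_int AE_f mean unfolding x_def by simp
qed

section \<open>Dilated cubes, the zero-one law and the ergodic case\<close>

definition dilation :: "nat \<Rightarrow> real" where
  "dilation m = 1 + 1 / real (Suc m)"

lemma dilation_gt_1: "1 < dilation m"
  by (simp add: dilation_def)

text \<open>Strictness matters: the gap between consecutive factors, multiplied by the growing sides
  of \<open>u j\<close>, eventually exceeds any fixed translation.\<close>

lemma dilation_Suc_less: "dilation (Suc m) < dilation m"
  by (simp add: dilation_def frac_less2)

lemma dilation_LIMSEQ: "dilation \<longlonglongrightarrow> 1"
proof -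
  have "(\<lambda>m. 1 + 1 / real (Suc m)) \<longlonglongrightarrow> 1 + 0"
    using LIMSEQ_inverse_real_of_nat by (intro tendsto_add tendsto_const) (simp add: inverse_eq_divide)
  then show ?thesis unfolding dilation_def by simp
qed

lemma vol_dilated_corner_cube:
  assumes "0 < c" "\<And>i. 0 < v $ i"
  shows "vol (corner_cube (c *\<^sub>R v)) = c ^ CARD('n) * vol (corner_cube (v :: real ^ 'n))"
  using assms by (simp add: vol_corner_cube prod.distrib)

text \<open>
  Subadditivity gives no control on a box by the boxes containing it, so the event that the limit
  along \<open>u\<close> is at most \<open>t\<close> is not visibly invariant. The event below is monotone under
  translations by nonnegative vectors, since a translate of a dilated cube fits into a slightly
  more dilated one.
\<close>
definition low_event :: "(nat \<Rightarrow> real ^ 'n) \<Rightarrow> real \<Rightarrow> 'a set" where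
  "low_event u t = {\<omega>\<in>space M. \<forall>m k::nat. \<forall>N. \<exists>j\<ge>N. R (corner_cube (dilation m *\<^sub>R u j)) \<omega>
      \<le> (t + C * (dilation m ^ CARD('n) - 1) + 1 / real (Suc k)) * vol (corner_cube (u j))}"

context
  fixes u :: "nat \<Rightarrow> real ^ 'n"
  assumes u_pos: "\<And>j i. 0 < u j $ i" and u_mono: "\<And>i. mono (\<lambda>j. u j $ i)"
    and u_lim: "\<And>i. filterlim (\<lambda>j. u j $ i) at_top sequentially"
begin

lemma dilated_pos: "0 < (dilation m *\<^sub>R u j) $ i"
  using u_pos[of j i] dilation_gt_1[of m] by simp

lemma low_event_measurable [measurable]: "low_event u t \<in> sets M"
proof -
  have [measurable]: "R (corner_cube (dilation m *\<^sub>R u j)) \<in> borel_measurable M" for m j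
    by (intro R_measurable corner_cube_in_cubes dilated_pos)
  show ?thesis unfolding low_event_def by measurable
qed

text \<open>The cost in \<open>R_subbox\<close> is exactly the difference of the correction terms of
  \<open>low_event\<close> for \<open>m\<close> and \<open>Suc m\<close>, so the clause for
  \<open>Suc m\<close> at the translate yields the clause for \<open>m\<close> at
  \<open>\<omega>\<close>, with the same \<open>k\<close>.\<close>

lemma low_event_translate:
  assumes \<omega>: "\<omega> \<in> space M" and s: "\<And>i. 0 \<le> s $ i" and low: "\<tau> s \<omega> \<in> low_event u t"
  shows "\<omega> \<in> low_event u t"
  unfolding low_event_def
proof (intro CollectI conjI \<omega> allI)
  fix m k N :: nat
  let ?c = "dilation m" and ?c' = "dilation (Suc m)"
  have "eventually (\<lambda>j. s $ i / (?c - ?c') \<le> u j $ i) sequentially" for i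
    using u_lim[of i] unfolding filterlim_at_top by blast
  then have "eventually (\<lambda>j. \<forall>i. s $ i / (?c - ?c') \<le> u j $ i) sequentially"
    by (rule eventually_all_finite)
  then obtain N' where N': "\<And>j i. N' \<le> j \<Longrightarrow> s $ i / (?c - ?c') \<le> u j $ i"
    unfolding eventually_sequentially by blast
  obtain j where j: "max N N' \<le> j" and
    le: "R (corner_cube (?c' *\<^sub>R u j)) (\<tau> s \<omega>)
      \<le> (t + C * (?c' ^ CARD('n) - 1) + 1 / real (Suc k)) * vol (corner_cube (u j))"
    using low unfolding low_event_def by blast
  let ?V = "vol (corner_cube (u j))"
  have fit: "s $ i + ?c' * u j $ i \<le> ?c * u j $ i" for i
    using N'[of j i] j dilation_Suc_less[of m] by (simp add: pos_divide_le_eq algebra_simps)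
  have "R (half_open_box 0 (?c *\<^sub>R u j)) \<omega> \<le> R (half_open_box (s + 0) (s + ?c' *\<^sub>R u j)) \<omega>
      + C * (vol (half_open_box 0 (?c *\<^sub>R u j)) - vol (half_open_box (s + 0) (s + ?c' *\<^sub>R u j)))"
    using s fit dilated_pos[of "Suc m" j] by (intro R_subbox \<omega>) simp_all
  also have "R (half_open_box (s + 0) (s + ?c' *\<^sub>R u j)) \<omega> = R (corner_cube (?c' *\<^sub>R u j)) (\<tau> s \<omega>)"
    unfolding corner_cube_def using dilated_pos[of "Suc m" j] by (intro R_translate \<omega>) simp
  also have "vol (half_open_box (s + 0) (s + ?c' *\<^sub>R u j)) = vol (corner_cube (?c' *\<^sub>R u j))"
    unfolding corner_cube_def using dilated_pos[of "Suc m" j]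
    by (subst (1 2) vol_half_open_box) (simp_all add: less_imp_le)
  also have "vol (corner_cube (?c' *\<^sub>R u j)) = ?c' ^ CARD('n) * ?V"
    using dilation_gt_1[of "Suc m"] by (intro vol_dilated_corner_cube u_pos) simp
  also have "vol (half_open_box 0 (?c *\<^sub>R u j)) = ?c ^ CARD('n) * ?V"
    using dilation_gt_1[of m] unfolding corner_cube_def[symmetric]
    by (intro vol_dilated_corner_cube u_pos) simp
  finally have "R (corner_cube (?c *\<^sub>R u j)) \<omega> \<le> R (corner_cube (?c' *\<^sub>R u j)) (\<tau> s \<omega>)
      + C * (?c ^ CARD('n) * ?V - ?c' ^ CARD('n) * ?V)"
    unfolding corner_cube_def[symmetric] .
  also have "\<dots> \<le> (t + C * (?c' ^ CARD('n) - 1) + 1 / real (Suc k)) * ?V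
      + C * (?c ^ CARD('n) * ?V - ?c' ^ CARD('n) * ?V)"
    using le by simp
  also have "\<dots> = (t + C * (?c ^ CARD('n) - 1) + 1 / real (Suc k)) * ?V"
    by (simp only: algebra_simps)
  finally show "\<exists>j\<ge>N. R (corner_cube (?c *\<^sub>R u j)) \<omega>
      \<le> (t + C * (?c ^ CARD('n) - 1) + 1 / real (Suc k)) * vol (corner_cube (u j))"
    using j by (intro exI[of _ j]) simp
qed

abbreviation (input) "diag \<equiv> \<lambda>n::nat. (\<chi> i::'n. real n)"

text \<open>Ergodicity speaks of strictly invariant sets, whereas the preimages of
  \<open>low_event\<close> under nonnegative translations are only known to be contained in it.
  Preimages along the diagonal decrease and have equal probability; their intersection keeps that
  probability and is invariant under every translation.\<close>

lemma low_event_zero_one: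
  assumes ergodic: "ergodic_group M \<tau>"
  shows "prob (low_event u t) = 0 \<or> prob (low_event u t) = 1"
proof -
  let ?B = "low_event u t"
  define D where "D n = \<tau> (diag n) -` ?B \<inter> space M" for n
  have D_meas [measurable]: "D n \<in> sets M" for n
    unfolding D_def by (rule measurable_sets[OF tau_measurable low_event_measurable])
  have D_prob: "prob (D n) = prob ?B" for n
  proof -
    have "prob ?B = measure (distr M M (\<tau> (diag n))) ?B" unfolding tau_distr ..
    also have "\<dots> = prob (D n)"
      unfolding D_def by (rule measure_distr[OF tau_measurable low_event_measurable])
    finally show ?thesis by (rule sym)
  qed
  have D_translate: "\<omega> \<in> D n" if "\<omega> \<in> space M" "\<tau> p \<omega> \<in> ?B" "\<And>i. real n \<le> p $ i" for n p \<omega>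
  proof -
    have shift: "\<tau> (p - diag n) (\<tau> (diag n) \<omega>) = \<tau> p \<omega>"
      using tau_add[OF that(1), of "p - diag n" "diag n"] by simp
    have "\<tau> (diag n) \<omega> \<in> ?B"
    proof (rule low_event_translate[OF tau_space[OF that(1)]])
      show "0 \<le> (p - diag n) $ i" for i using that(3)[of i] by simp
      show "\<tau> (p - diag n) (\<tau> (diag n) \<omega>) \<in> ?B" unfolding shift by (rule that(2))
    qed
    then show ?thesis unfolding D_def using that(1) by blast
  qed
  have D_Suc: "D (Suc n) \<subseteq> D n" for n
  proof
    fix \<omega> assume "\<omega> \<in> D (Suc n)"
    then have "\<omega> \<in> space M" "\<tau> (diag (Suc n)) \<omega> \<in> ?B" unfolding D_def by blast+
    then show "\<omega> \<in> D n" by (rule D_translate) simp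
  qed
  have "(\<lambda>n. prob (D n)) \<longlonglongrightarrow> prob (\<Inter>n. D n)"
    by (rule finite_Lim_measure_decseq) (use D_meas in blast, rule decseq_SucI, rule D_Suc)
  then have prob_eq: "prob (\<Inter>n. D n) = prob ?B"
    unfolding D_prob by (simp add: LIMSEQ_const_iff)
  have "\<tau> s -` (\<Inter>n. D n) \<inter> space M = (\<Inter>n. D n)" for s
  proof -
    \<comment> \<open>Going \<open>q\<close> further along the diagonal absorbs a translation by
      \<open>s\<close> or by its negative.\<close>
    obtain q :: nat where q: "\<And>i. \<bar>s $ i\<bar> \<le> real q"
    proof -
      obtain q where q: "norm s \<le> real q" using real_arch_simple by blast
      have "\<bar>s $ i\<bar> \<le> real q" for i
        using component_le_norm_cart[of s i] q by linarith
      then show ?thesis by (rule that)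
    qed
    show ?thesis
    proof (intro set_eqI iffI INT_I)
      fix \<omega> n assume "\<omega> \<in> \<tau> s -` (\<Inter>n. D n) \<inter> space M"
      then have \<omega>: "\<omega> \<in> space M" "\<tau> (diag (n + q)) (\<tau> s \<omega>) \<in> ?B"
        unfolding D_def by blast+
      show "\<omega> \<in> D n"
      proof (rule D_translate[OF \<omega>(1)])
        show "\<tau> (diag (n + q) + s) \<omega> \<in> ?B" using \<omega> by (simp add: tau_add)
        show "real n \<le> (diag (n + q) + s) $ i" for i using q[of i] by simp
      qed
    next
      fix \<omega> assume \<omega>_in: "\<omega> \<in> (\<Inter>n. D n)"
      have \<omega>: "\<omega> \<in> space M" "\<tau> (diag n) \<omega> \<in> ?B" for n
        using \<omega>_in unfolding D_def by blast+
      have "\<tau> s \<omega> \<in> D n" for n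
      proof (rule D_translate[of _ "diag (n + q) - s"])
        show "\<tau> s \<omega> \<in> space M" by (rule tau_space[OF \<omega>(1)])
        show "\<tau> (diag (n + q) - s) (\<tau> s \<omega>) \<in> ?B"
          using \<omega>(2)[of "n + q"] tau_add[OF \<omega>(1), of "diag (n + q) - s" s] by simp
        show "real n \<le> (diag (n + q) - s) $ i" for i using q[of i] by simp
      qed
      then show "\<omega> \<in> \<tau> s -` (\<Inter>n. D n) \<inter> space M" using \<omega>(1) by blast
    qed
  qed
  moreover have "(\<Inter>n. D n) \<in> sets M" by measurable
  ultimately have "prob (\<Inter>n. D n) = 0 \<or> prob (\<Inter>n. D n) = 1"
    using ergodic unfolding ergodic_group_def by blast
  then show ?thesis unfolding prob_eq .
qed

text \<open>Along the dilated sequence there is again a limit with mean \<open>\<gamma>\<close>. Low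
  values at arbitrarily large \<open>j\<close> bound this limit from above; integrating and letting
  the dilation tend to 1 removes the correction.\<close>

lemma spatial_constant_le_of_low_event:
  assumes low: "AE \<omega> in M. \<omega> \<in> low_event u t"
  shows "\<gamma> \<le> t"
proof -
  let ?d = "CARD('n)"
  have le: "dilation m ^ ?d * \<gamma> \<le> t + C * (dilation m ^ ?d - 1)" for m
  proof -
    let ?c = "dilation m"
    have c: "0 < ?c" "0 < ?c ^ ?d" using dilation_gt_1[of m] by simp_all
    obtain f where f: "integrable M f"
      "AE \<omega> in M. (\<lambda>j. R (corner_cube (?c *\<^sub>R u j)) \<omega> / vol (corner_cube (?c *\<^sub>R u j))) \<longlonglongrightarrow> f \<omega>"
      "(\<integral>\<omega>. f \<omega> \<partial>M) = \<gamma>"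
    proof (rule corner_cube_limit[of "\<lambda>j. ?c *\<^sub>R u j"])
      show "0 < (?c *\<^sub>R u j) $ i" for j i by (rule dilated_pos)
      show "mono (\<lambda>j. (?c *\<^sub>R u j) $ i)" for i
        using u_mono[of i] c(1) by (auto simp: mono_def)
      show "filterlim (\<lambda>j. (?c *\<^sub>R u j) $ i) at_top sequentially" for i
        using filterlim_tendsto_pos_mult_at_top[OF tendsto_const c(1) u_lim[of i]] by simp
    qed
    have "AE \<omega> in M. f \<omega> \<le> (t + C * (?c ^ ?d - 1)) / ?c ^ ?d"
      using low f(2)
    proof eventually_elim
      case (elim \<omega>)
      show ?case
      proof (rule field_le_epsilon)
        fix e :: real assume e: "0 < e"
        then have "0 < e * ?c ^ ?d / 2" using c by simp
        then obtain k where k: "inverse (real (Suc k)) < e * ?c ^ ?d / 2"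
          using reals_Archimedean by blast
        obtain N where N: "\<And>j. N \<le> j \<Longrightarrow>
            f \<omega> - e / 2 < R (corner_cube (?c *\<^sub>R u j)) \<omega> / vol (corner_cube (?c *\<^sub>R u j))"
          using order_tendstoD(1)[OF elim(2), of "f \<omega> - e / 2"] e
          unfolding eventually_sequentially by auto
        obtain j where j: "N \<le> j" and R_le: "R (corner_cube (?c *\<^sub>R u j)) \<omega>
            \<le> (t + C * (?c ^ ?d - 1) + 1 / real (Suc k)) * vol (corner_cube (u j))"
          using elim(1) unfolding low_event_def by blast
        have V: "0 < vol (corner_cube (u j))" by (intro vol_corner_cube_pos u_pos)
        have "R (corner_cube (?c *\<^sub>R u j)) \<omega> / vol (corner_cube (?c *\<^sub>R u j))
            = R (corner_cube (?c *\<^sub>R u j)) \<omega> / vol (corner_cube (u j)) / ?c ^ ?d"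
          by (subst vol_dilated_corner_cube[OF c(1) u_pos]) simp
        also have "\<dots> \<le> (t + C * (?c ^ ?d - 1) + 1 / real (Suc k)) / ?c ^ ?d"
          using R_le V c by (intro divide_right_mono) (simp_all add: pos_divide_le_eq)
        also have "\<dots> \<le> (t + C * (?c ^ ?d - 1)) / ?c ^ ?d + e / 2"
        proof -
          have "1 / real (Suc k) / ?c ^ ?d \<le> (e * ?c ^ ?d / 2) / ?c ^ ?d"
            using k c unfolding inverse_eq_divide by (intro divide_right_mono less_imp_le) auto
          also have "\<dots> = e / 2" using c by simp
          finally show ?thesis unfolding add_divide_distrib[of _ "1 / real (Suc k)"] by simp
        qed
        finally show "f \<omega> \<le> (t + C * (?c ^ ?d - 1)) / ?c ^ ?d + e"
          using N[OF j] by linarith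
      qed
    qed
    then have "(\<integral>\<omega>. f \<omega> \<partial>M) \<le> (\<integral>\<omega>. (t + C * (?c ^ ?d - 1)) / ?c ^ ?d \<partial>M)"
      using f(1) by (intro integral_mono_AE) simp_all
    then show ?thesis
      using f(3) c by (simp add: prob_space pos_le_divide_eq mult.commute)
  qed
  have "(\<lambda>m. dilation m ^ ?d * \<gamma>) \<longlonglongrightarrow> 1 ^ ?d * \<gamma>"
    by (intro tendsto_mult tendsto_power tendsto_const dilation_LIMSEQ)
  moreover have "(\<lambda>m. t + C * (dilation m ^ ?d - 1)) \<longlonglongrightarrow> t + C * (1 ^ ?d - 1)"
    by (intro tendsto_add tendsto_mult tendsto_diff tendsto_power tendsto_const dilation_LIMSEQ)
  ultimately have "1 ^ ?d * \<gamma> \<le> t + C * (1 ^ ?d - 1)"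
    using le by (intro LIMSEQ_le) auto
  then show ?thesis by simp
qed

text \<open>Enlarging a cube by the factor \<open>dilation m\<close> costs \<open>C\<close> times
  the added volume, which is the origin of the correction term in \<open>low_event\<close>.\<close>

lemma limit_le_imp_low_event:
  assumes \<omega>: "\<omega> \<in> space M"
    and lim: "(\<lambda>j. R (corner_cube (u j)) \<omega> / vol (corner_cube (u j))) \<longlonglongrightarrow> r" and r: "r \<le> t"
  shows "\<omega> \<in> low_event u t"
  unfolding low_event_def
proof (intro CollectI conjI \<omega> allI)
  fix m k N :: nat
  let ?c = "dilation m"
  have "0 < 1 / real (Suc k)" by simp
  then have "r < t + 1 / real (Suc k)" using r by linarith
  then have "eventually (\<lambda>j. R (corner_cube (u j)) \<omega> / vol (corner_cube (u j)) < t + 1 / real (Suc k)) sequentially"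
    by (rule order_tendstoD(2)[OF lim])
  then obtain N' where N': "\<And>j. N' \<le> j \<Longrightarrow>
      R (corner_cube (u j)) \<omega> / vol (corner_cube (u j)) < t + 1 / real (Suc k)"
    unfolding eventually_sequentially by blast
  define j where "j = max N N'"
  let ?V = "vol (corner_cube (u j))"
  have V: "0 < ?V" by (intro vol_corner_cube_pos u_pos)
  have le: "R (corner_cube (u j)) \<omega> \<le> (t + 1 / real (Suc k)) * ?V"
    using N'[of j] V unfolding j_def by (simp add: pos_divide_less_eq)
  have "R (corner_cube (?c *\<^sub>R u j)) \<omega>
      \<le> R (corner_cube (u j)) \<omega> + C * (vol (corner_cube (?c *\<^sub>R u j)) - ?V)"
    using u_pos[of j] dilation_gt_1[of m] by (intro R_corner_subbox \<omega>) simp_all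
  also have "vol (corner_cube (?c *\<^sub>R u j)) = ?c ^ CARD('n) * ?V"
    using dilation_gt_1[of m] by (intro vol_dilated_corner_cube u_pos) simp
  also have "R (corner_cube (u j)) \<omega> + C * (?c ^ CARD('n) * ?V - ?V)
      \<le> (t + 1 / real (Suc k)) * ?V + C * (?c ^ CARD('n) * ?V - ?V)"
    using le by simp
  also have "\<dots> = (t + C * (?c ^ CARD('n) - 1) + 1 / real (Suc k)) * ?V"
    by (simp only: algebra_simps)
  finally show "\<exists>j\<ge>N. R (corner_cube (?c *\<^sub>R u j)) \<omega>
      \<le> (t + C * (?c ^ CARD('n) - 1) + 1 / real (Suc k)) * vol (corner_cube (u j))"
    by (intro exI[of _ j]) (simp add: j_def)
qed

text \<open>For \<open>t < \<gamma>\<close> the event \<open>low_event u t\<close> cannot have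
  probability 1, so it is null and \<open>f\<close> exceeds \<open>t\<close>. A function that is at
  least \<open>\<gamma>\<close> and has mean \<open>\<gamma>\<close> equals it almost
  surely.\<close>

lemma ergodic_limit:
  assumes ergodic: "ergodic_group M \<tau>"
    and f: "integrable M f" "(\<integral>\<omega>. f \<omega> \<partial>M) = \<gamma>"
    and lim: "AE \<omega> in M. (\<lambda>j. R (corner_cube (u j)) \<omega> / vol (corner_cube (u j))) \<longlonglongrightarrow> f \<omega>"
  shows "AE \<omega> in M. f \<omega> = \<gamma>"
proof -
  have above: "AE \<omega> in M. t < f \<omega>" if t: "t < \<gamma>" for t
  proof -
    have "prob (low_event u t) \<noteq> 1"
    proof
      assume "prob (low_event u t) = 1"
      then have "AE \<omega> in M. \<omega> \<in> low_event u t" by (rule AE_prob_1)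
      then show False using spatial_constant_le_of_low_event t by fastforce
    qed
    then have "prob (low_event u t) = 0"
      using low_event_zero_one[OF ergodic] by blast
    then have "AE \<omega> in M. \<omega> \<notin> low_event u t"
      by (intro AE_not_in) (simp add: null_sets_def emeasure_eq_measure)
    then show ?thesis
      using lim AE_space
    proof eventually_elim
      case (elim \<omega>)
      then show ?case using limit_le_imp_low_event[of \<omega> "f \<omega>" t] by (meson not_le)
    qed
  qed
  have "AE \<omega> in M. \<forall>k::nat. \<gamma> - 1 / real (Suc k) < f \<omega>"
    unfolding AE_all_countable by (intro allI above) simp
  then have nonneg: "AE \<omega> in M. 0 \<le> f \<omega> - \<gamma>"
  proof eventually_elim
    case (elim \<omega>)
    have "\<gamma> \<le> f \<omega>"
    proof (rule field_le_epsilon)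
      fix e :: real assume "0 < e"
      then obtain k where "inverse (real (Suc k)) < e" using reals_Archimedean by blast
      then show "\<gamma> \<le> f \<omega> + e"
        using elim[rule_format, of k] unfolding inverse_eq_divide by linarith
    qed
    then show ?case by simp
  qed
  have "(\<integral>\<omega>. f \<omega> - \<gamma> \<partial>M) = 0"
    using f by (simp add: prob_space)
  then have "AE \<omega> in M. f \<omega> - \<gamma> = 0"
    using integral_nonneg_eq_0_iff_AE[of M "\<lambda>\<omega>. f \<omega> - \<gamma>"] nonneg f(1) by simp
  then show ?thesis by eventually_elim simp
qed

end

end

text \<open>Both conclusions come from test points: points of axis \<open>i\<close> just below the
  face for monotonicity, and the vector with all entries \<open>abs z\<close> for
  divergence.\<close>

lemma corner_cubes_exhaust_orthant:
  fixes u :: "nat \<Rightarrow> real ^ 'n"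
  assumes pos: "\<And>j i. 0 < u j $ i"
    and sub: "\<And>j. corner_cube (u j) \<subseteq> corner_cube (u (Suc j))"
    and Un: "(\<Union>j. corner_cube (u j)) = {x. \<forall>i. 0 \<le> x $ i}"
  shows "mono (\<lambda>j. u j $ i)" and "filterlim (\<lambda>j. u j $ i) at_top sequentially"
proof -
  have "u j $ i \<le> u (Suc j) $ i" for j
  proof (rule dense_le_bounded[OF pos[of j i]])
    fix t assume t: "0 < t" "t < u j $ i"
    have "vec_upd 0 i t \<in> corner_cube (u j)"
      using t pos[of j] unfolding corner_cube_def half_open_box_def by simp
    then have "vec_upd 0 i t \<in> corner_cube (u (Suc j))" using sub by blast
    then have "vec_upd 0 i t $ i < u (Suc j) $ i"
      unfolding corner_cube_def half_open_box_def by blast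
    then show "t \<le> u (Suc j) $ i" by simp
  qed
  then show mono: "mono (\<lambda>j. u j $ i)" by (simp add: mono_iff_le_Suc)
  show "filterlim (\<lambda>j. u j $ i) at_top sequentially"
    unfolding filterlim_at_top
  proof
    fix z :: real
    have "(\<chi> j. \<bar>z\<bar>) \<in> (\<Union>j. corner_cube (u j))" unfolding Un by simp
    then obtain N where "(\<chi> j. \<bar>z\<bar>) \<in> corner_cube (u N)" by blast
    then have "(\<chi> j. \<bar>z\<bar>) $ i < u N $ i"
      unfolding corner_cube_def half_open_box_def by blast
    then have N: "z \<le> u N $ i" by simp
    have "z \<le> u j $ i" if "N \<le> j" for j
      using monoD[OF mono that] N by linarith
    then show "eventually (\<lambda>j. z \<le> u j $ i) sequentially"
      unfolding eventually_sequentially by blast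
  qed
qed

theorem theoremA1:
  fixes M :: "'a measure"
    and \<tau> :: "real ^ 'n \<Rightarrow> 'a \<Rightarrow> 'a"
    and R :: "(real ^ 'n) set \<Rightarrow> 'a \<Rightarrow> real"
    and u :: "nat \<Rightarrow> real ^ 'n"
  assumes "prob_space M"
    and "mp_group M \<tau>"
    and "cube_process M R"
    and "stationary M \<tau> R"
    and "cube_subadditive M R"
    and "volume_bounded M R"
    and "\<And>j i. 0 < u j $ i"
    and "\<And>j. corner_cube (u j) \<subseteq> corner_cube (u (Suc j))"
    and "(\<Union>j. corner_cube (u j)) = {x. \<forall>i. 0 \<le> x $ i}"
  shows "\<exists>Rlim :: 'a \<Rightarrow> real.
    integrable M Rlim \<and>
    (AE \<omega> in M. (\<lambda>j. R (corner_cube (u j)) \<omega> / vol (corner_cube (u j))) \<longlonglongrightarrow> Rlim \<omega>) \<and>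
    (\<lambda>j. 1 / vol (corner_cube (u j)) * (\<integral>\<omega>. R (corner_cube (u j)) \<omega> \<partial>M))
      \<longlonglongrightarrow> (\<integral>\<omega>. Rlim \<omega> \<partial>M) \<and>
    (ergodic_group M \<tau> \<longrightarrow> (AE \<omega> in M. Rlim \<omega> = spatial_constant M R))"
proof -
  obtain C where C: "\<forall>\<omega>\<in>space M. \<forall>I\<in>cubes. 0 \<le> R I \<omega> \<and> R I \<omega> \<le> C * vol I"
    using assms(6) unfolding volume_bounded_def by blast
  interpret prob_space M by (rule assms(1))
  interpret subadditive_cube_process M \<tau> R C
    by unfold_locales (use assms(2-5) C in blast)+
  note u = assms(7) corner_cubes_exhaust_orthant[OF assms(7-9)]
  obtain f where f: "integrable M f"
    "AE \<omega> in M. (\<lambda>j. R (corner_cube (u j)) \<omega> / vol (corner_cube (u j))) \<longlonglongrightarrow> f \<omega>"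
    "(\<lambda>j. (\<integral>\<omega>. R (corner_cube (u j)) \<omega> \<partial>M) / vol (corner_cube (u j))) \<longlonglongrightarrow> spatial_constant M R"
    "(\<integral>\<omega>. f \<omega> \<partial>M) = spatial_constant M R"
    using corner_cube_limit[OF u] by blast
  show ?thesis
  proof (intro exI[of _ f] conjI impI f(1,2))
    show "(\<lambda>j. 1 / vol (corner_cube (u j)) * (\<integral>\<omega>. R (corner_cube (u j)) \<omega> \<partial>M)) \<longlonglongrightarrow> (\<integral>\<omega>. f \<omega> \<partial>M)"
      using f(3) unfolding f(4) by simp
    show "AE \<omega> in M. f \<omega> = spatial_constant M R" if "ergodic_group M \<tau>"
      by (rule ergodic_limit[OF u that f(1,4,2)])
  qed
qed

end
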